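(* Let $E\subseteq\mathbb{R}^2$ be a set with optimal oracles. Let $0<s\le\min\{\dim_H(E),1\}$. Then $$\dim_H\big(\{e\in\mathcal{S}^1 \mid \dim_H(p_eE)<s\}\big)\le s.$$
   Context: $\mathcal{S}^1$ is the unit circle in $\mathbb{R}^2$. For $e\in\mathcal{S}^1$ and $x\in\mathbb{R}^2$, $p_ex=e\cdot x\in\mathbb{R}$ and $p_eE=\{p_ex: x\in E\}$. $\dim_H$ is Hausdorff dimension. Kolmogorov complexity: fix a universal prefix-free oracle Turing machine $U$. For an oracle $A\subseteq\mathbb{N}$ and a binary string $\sigma$, $K^A(\sigma)=\min\{|\pi|: U^A(\pi,\lambda)=\sigma\}$, where $\lambda$ is the empty string and $|\pi|$ is the length of the binary string $\pi$. Rational vectors are encoded as strings in a fixed way. For $x\in\mathbb{R}^n$ and $r\in\mathbb{N}$, $K^A_r(x)=\min\{K^A(p): p\in\mathbb{Q}^n\cap B_{2^{-r}}(x)\}$. Define $\dim^A(x)=\liminf_{r\to\infty}K^A_r(x)/r$. A superscript $A,B$ means access to both oracles (their join). An oracle $A\subseteq\mathbb{N}$ is a Hausdorff oracle for $E\subseteq\mathbb{R}^n$ if $\dim_H(E)=\sup_{x\in E}\dim^A(x)$ (by the point-to-set principle, $\dim_H(E)=\min_{A\subseteq\mathbb{N}}\sup_{x\in E}\dim^A(x)$, so such oracles exist). An oracle $A\subseteq\mathbb{N}$ is Hausdorff optimal for $E$ if (1) $A$ is a Hausdorff oracle for $E$, and (2) for every $B\subseteq\mathbb{N}$ and $\varepsilon>0$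 there is some $x\in E$ such that $\dim^{A,B}(x)>\dim_H(E)-\varepsilon$ and, for all sufficiently large $r$, $K^{A,B}_r(x)\ge K^A_r(x)-\varepsilon r$. A set $E$ has optimal oracles if there exists an oracle that is Hausdorff optimal for $E$. *)

theory Defs
  imports "HOL-Analysis.Analysis" "HOL-Library.Sublist"
begin

section \<open>Hausdorff dimension\<close>

text \<open>Coverings may contain empty sets, so finite coverings are included. Boundedness is
  demanded explicitly because \<^const>\<open>diameter\<close> is meaningful only on bounded sets.\<close>

definition hausdorff_content :: "real \<Rightarrow> real \<Rightarrow> 'a::metric_space set \<Rightarrow> ennreal" where
  "hausdorff_content \<delta> s E =
     (INF C\<in>{C :: nat \<Rightarrow> 'a set. E \<subseteq> (\<Union>i. C i) \<and> (\<forall>i. bounded (C i) \<and> diameter (C i) \<le> \<delta>)}.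
        \<Sum>i. ennreal (diameter (C i) powr s))"

definition hausdorff_measure :: "real \<Rightarrow> 'a::metric_space set \<Rightarrow> ennreal" where
  "hausdorff_measure s E = (SUP \<delta>\<in>{0<..}. hausdorff_content \<delta> s E)"

text \<open>The exponent 0 is left out because \<open>0 powr 0 = 0\<close>, which would give points measure 0;
  the infimum is the same.\<close>

definition hausdorff_dim :: "'a::metric_space set \<Rightarrow> ennreal" where
  "hausdorff_dim E = (INF s\<in>{s. 0 < s \<and> hausdorff_measure s E = 0}. ennreal s)"


section \<open>Oracle Turing machines\<close>

text \<open>
  Deterministic multi-tape machines with two-way infinite tapes. Symbol 0 is the blank, symbols 1
  and 2 are the bits 0 and 1. The machine starts in state 0 and halts in state 1. Tapes 0, 1, 2, 3
  are the program, input, oracle and output tape, the remaining ones are work tapes. The oracle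
  tape is read-only and carries the characteristic sequence of the oracle on the cells
  \<open>0, 1, 2, \<dots>\<close>. The transition function maps a state and the list of scanned symbols to the new
  state and, for each tape, the symbol written and the head movement.
\<close>

record otm =
  num_states :: nat
  num_symbols :: nat
  num_tapes :: nat
  transition :: "nat \<Rightarrow> nat list \<Rightarrow> nat \<times> (nat \<times> int) list"

definition otm_wf :: "otm \<Rightarrow> bool" where
  "otm_wf M \<longleftrightarrow> 2 \<le> num_states M \<and> 3 \<le> num_symbols M \<and> 4 \<le> num_tapes M \<and>
     (\<forall>q xs. q < num_states M \<and> length xs = num_tapes M \<and> set xs \<subseteq> {..<num_symbols M} \<longrightarrow>
        (case transition M q xs of (q', acts) \<Rightarrow>
           q' < num_states M \<and> length acts = num_tapes M \<and>
           set acts \<subseteq> {..<num_symbols M} \<times> {-1, 0, 1} \<and> fst (acts ! 2) = xs ! 2))"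

text \<open>A configuration consists of the state, the head positions and the tape contents.\<close>

type_synonym otm_config = "nat \<times> (nat \<Rightarrow> int) \<times> (nat \<Rightarrow> int \<Rightarrow> nat)"

definition otm_step :: "otm \<Rightarrow> otm_config \<Rightarrow> otm_config" where
  "otm_step M = (\<lambda>(q, h, t).
     if q = 1 then (q, h, t)
     else case transition M q (map (\<lambda>i. t i (h i)) [0..<num_tapes M]) of (q', acts) \<Rightarrow>
       (q',
        \<lambda>i. if i < num_tapes M then h i + snd (acts ! i) else h i,
        \<lambda>i. if i < num_tapes M then (t i)(h i := fst (acts ! i)) else t i))"

definition bit_symbol :: "bool \<Rightarrow> nat" where
  "bit_symbol b = (if b then 2 else 1)"

definition string_tape :: "bool list \<Rightarrow> int \<Rightarrow> nat" where
  "string_tape w z = (if 0 \<le> z \<and> z < int (length w) then bit_symbol (w ! nat z) else 0)"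

definition oracle_tape :: "nat set \<Rightarrow> int \<Rightarrow> nat" where
  "oracle_tape A z = (if 0 \<le> z then bit_symbol (nat z \<in> A) else 0)"

definition otm_init :: "nat set \<Rightarrow> bool list \<Rightarrow> bool list \<Rightarrow> otm_config" where
  "otm_init A \<pi> \<tau> =
     (0, \<lambda>_. 0,
      (\<lambda>_ _. 0)(0 := string_tape \<pi>, 1 := string_tape \<tau>, 2 := oracle_tape A))"

text \<open>\<open>otm_computes M A \<pi> \<tau> \<sigma>\<close> means \<open>M\<^sup>A(\<pi>, \<tau>) = \<sigma>\<close>. The output is the string that begins
  in cell 0 of the output tape and extends to the first blank.\<close>

definition otm_computes :: "otm \<Rightarrow> nat set \<Rightarrow> bool list \<Rightarrow> bool list \<Rightarrow> bool list \<Rightarrow> bool" where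
  "otm_computes M A \<pi> \<tau> \<sigma> \<longleftrightarrow>
     (\<exists>n h t. (otm_step M ^^ n) (otm_init A \<pi> \<tau>) = (1, h, t) \<and>
        (\<forall>i\<le>length \<sigma>. t 3 (int i) = string_tape \<sigma> (int i)))"

definition prefix_free_otm :: "otm \<Rightarrow> bool" where
  "prefix_free_otm M \<longleftrightarrow> otm_wf M \<and>
     (\<forall>A \<tau> \<pi> \<pi>' \<sigma> \<sigma>'. otm_computes M A \<pi> \<tau> \<sigma> \<and> otm_computes M A \<pi>' \<tau> \<sigma>' \<longrightarrow>
        \<not> strict_prefix \<pi> \<pi>')"

definition universal_prefix_free_otm :: "otm \<Rightarrow> bool" where
  "universal_prefix_free_otm U \<longleftrightarrow> prefix_free_otm U \<and>
     (\<forall>M. prefix_free_otm M \<longrightarrow>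
        (\<exists>\<rho>. \<forall>A \<pi> \<tau> \<sigma>. otm_computes U A (\<rho> @ \<pi>) \<tau> \<sigma> \<longleftrightarrow> otm_computes M A \<pi> \<tau> \<sigma>))"


section \<open>Kolmogorov complexity\<close>

definition complexity :: "otm \<Rightarrow> nat set \<Rightarrow> bool list \<Rightarrow> nat" where
  "complexity U A \<sigma> = (LEAST l. \<exists>\<pi>. length \<pi> = l \<and> otm_computes U A \<pi> [] \<sigma>)"

fun binary_digits :: "nat \<Rightarrow> bool list" where
  "binary_digits n = (if n = 0 then [] else odd n # binary_digits (n div 2))"

declare binary_digits.simps [simp del]

text \<open>Doubling the digits and ending with \<open>01\<close> makes the code self-delimiting, so that codes
  can be concatenated.\<close>

definition encode_nat :: "nat \<Rightarrow> bool list" where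
  "encode_nat n = concat (map (\<lambda>b. [b, b]) (binary_digits n)) @ [False, True]"

definition encode_rat :: "rat \<Rightarrow> bool list" where
  "encode_rat q = (case quotient_of q of (a, b) \<Rightarrow>
     (a < 0) # encode_nat (nat \<bar>a\<bar>) @ encode_nat (nat b))"

definition encode_rat_vec :: "rat ^ 'n::{finite,linorder} \<Rightarrow> bool list" where
  "encode_rat_vec p = concat (map (\<lambda>i. encode_rat (p $ i)) (sorted_list_of_set UNIV))"

definition complexity_at ::
    "otm \<Rightarrow> nat set \<Rightarrow> nat \<Rightarrow> real ^ 'n::{finite,linorder} \<Rightarrow> nat" where
  "complexity_at U A r x =
     (LEAST l. \<exists>p :: rat ^ 'n::{finite,linorder}. (\<chi> i. of_rat (p $ i)) \<in> ball x (1 / 2 ^ r) \<and>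
        l = complexity U A (encode_rat_vec p))"

definition effective_dim :: "otm \<Rightarrow> nat set \<Rightarrow> real ^ 'n::{finite,linorder} \<Rightarrow> ennreal" where
  "effective_dim U A x = liminf (\<lambda>r. ennreal (real (complexity_at U A r x) / real r))"

definition oracle_join :: "nat set \<Rightarrow> nat set \<Rightarrow> nat set" where
  "oracle_join A B = (\<lambda>n. 2 * n) ` A \<union> (\<lambda>n. 2 * n + 1) ` B"


section \<open>Optimal oracles\<close>

definition hausdorff_oracle :: "otm \<Rightarrow> nat set \<Rightarrow> (real ^ 'n::{finite,linorder}) set \<Rightarrow> bool" where
  "hausdorff_oracle U A E \<longleftrightarrow> hausdorff_dim E = (SUP x\<in>E. effective_dim U A x)"

text \<open>The dimension condition is \<open>dim\<^sup>A\<^sup>,\<^sup>B(x) > dim\<^sub>H(E) - \<epsilon>\<close> with \<open>\<epsilon>\<close> moved to the other side,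
  because subtraction on \<^typ>\<open>ennreal\<close> truncates at 0.\<close>

definition hausdorff_optimal ::
    "otm \<Rightarrow> nat set \<Rightarrow> (real ^ 'n::{finite,linorder}) set \<Rightarrow> bool" where
  "hausdorff_optimal U A E \<longleftrightarrow> hausdorff_oracle U A E \<and>
     (\<forall>B. \<forall>\<epsilon>::real. 0 < \<epsilon> \<longrightarrow>
        (\<exists>x\<in>E. hausdorff_dim E < effective_dim U (oracle_join A B) x + ennreal \<epsilon> \<and>
           (\<forall>\<^sub>F r in sequentially.
              real (complexity_at U (oracle_join A B) r x)
                \<ge> real (complexity_at U A r x) - \<epsilon> * real r)))"

definition has_optimal_oracles :: "otm \<Rightarrow> (real ^ 'n::{finite,linorder}) set \<Rightarrow> bool" where
  "has_optimal_oracles U E \<longleftrightarrow> (\<exists>A. hausdorff_optimal U A E)"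

end

theory Submission
  imports Defs "HOL-Real_Asymp.Real_Asymp"
begin

text \<open>
  Kaufman's energy argument is carried out by counting, and the optimal oracle \<open>A\<close> enters only
  through the finite sets \<open>P\<^sub>k\<close> of rational points of complexity at most \<open>k\<close> relative to \<open>A\<close>, which
  have at most \<open>2 ^ (k + 1)\<close> elements. Call a point of \<open>P\<^sub>k\<close> spread if \<open>P\<^sub>k\<close> has at most
  \<open>2 powr (k - (s - \<epsilon>) j)\<close> points within \<open>2\<^sup>-\<^sup>j\<close> of it, for all relevant \<open>j \<le> r\<close>. Two points at distance
  \<open>2\<^sup>-\<^sup>j\<close> project to within \<open>2\<^sup>-\<^sup>r\<close> of each other only for directions in two arcs of length about
  \<open>2 powr (j - r)\<close>. Hence the directions for which more than \<open>2 powr (2 k - (s - 2 \<epsilon>) r)\<close> pairs of spread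
  points do so can be covered by arcs with \<open>\<Sum> length powr s\<close> about \<open>2 powr (- \<epsilon> r)\<close>, and the directions
  that are exceptional for infinitely many \<open>r\<close> form a null set for the \<open>s\<close>-dimensional measure.

  Let \<open>e\<close> be any other direction, and suppose that \<open>p\<^sub>e E\<close> has dimension below \<open>s - 5 \<epsilon>\<close>. Cover it
  by few short intervals. For every \<open>x \<in> E\<close> there are infinitely many \<open>r\<close> such that an approximation
  of \<open>x\<close> in \<open>P\<^sub>k\<close>, where \<open>k = K\<^sub>r(x)\<close>, either is not spread or is among the at most
  \<open>2 powr (k - \<epsilon> r + 1)\<close> points of \<open>P\<^sub>k\<close> that lie in a light tube over the cover or in a heavy tube.
  An oracle \<open>B\<close> that lists these points, together with nets of the points that are not spread, lowers
  the dimension or the complexity of \<open>x\<close> by more than optimality of \<open>A\<close> allows. The oracle may be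
  chosen arbitrarily, so the only computation needed is a table lookup.
\<close>


section \<open>Runs of oracle machines\<close>

lemma halted_funpow: "(otm_step M ^^ n) (1, h, t) = (1, h, t)"
  by (induction n) (auto simp: otm_step_def)

lemma halted_unique:
  assumes "(otm_step M ^^ n) c = (1, h, t)" "(otm_step M ^^ n') c = (1, h', t')"
  shows "h = h' \<and> t = t'"
proof -
  have *: "(h, t) = (h', t')"
    if "(otm_step M ^^ n) c = (1, h, t)" "(otm_step M ^^ n') c = (1, h', t')" "n \<le> n'"
    for n n' h h' t t'
  proof -
    have "(otm_step M ^^ n') c = (otm_step M ^^ (n' - n)) ((otm_step M ^^ n) c)"
      using that(3) by (metis comp_apply funpow_add le_add_diff_inverse2)
    then show ?thesis using that halted_funpow[of "n' - n" M h t] by simp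
  qed
  show ?thesis
    using *[OF assms] *[OF assms(2,1)] by (cases "n \<le> n'") auto
qed

lemma bit_symbol_inj [simp]: "bit_symbol a = bit_symbol b \<longleftrightarrow> a = b"
  by (auto simp: bit_symbol_def)

lemma bit_symbol_neq_0 [simp]: "bit_symbol a \<noteq> 0" "0 \<noteq> bit_symbol a"
  by (auto simp: bit_symbol_def)

lemma bit_symbol_eq_2 [simp]: "bit_symbol a = 2 \<longleftrightarrow> a"
  by (auto simp: bit_symbol_def)

text \<open>The condition at \<open>i = length \<sigma>\<close> demands a blank behind the output,
  so of two outputs read off the same final tape neither can be longer.\<close>

lemma otm_computes_unique:
  assumes "otm_computes M A \<pi> \<tau> \<sigma>" "otm_computes M A \<pi> \<tau> \<sigma>'"
  shows "\<sigma> = \<sigma>'"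
proof -
  from assms(1) obtain n h t where 1: "(otm_step M ^^ n) (otm_init A \<pi> \<tau>) = (1, h, t)"
    "\<forall>i\<le>length \<sigma>. t 3 (int i) = string_tape \<sigma> (int i)"
    unfolding otm_computes_def by blast
  from assms(2) obtain n' h' t' where 2: "(otm_step M ^^ n') (otm_init A \<pi> \<tau>) = (1, h', t')"
    "\<forall>i\<le>length \<sigma>'. t' 3 (int i) = string_tape \<sigma>' (int i)"
    unfolding otm_computes_def by blast
  have t: "t = t'" using halted_unique[OF 1(1) 2(1)] by simp
  have "\<not> length \<sigma> < length \<sigma>'"
    using 1(2)[rule_format, of "length \<sigma>"] 2(2)[rule_format, of "length \<sigma>"] t
    by (auto simp: string_tape_def)
  moreover have "\<not> length \<sigma>' < length \<sigma>"
    using 1(2)[rule_format, of "length \<sigma>'"] 2(2)[rule_format, of "length \<sigma>'"] t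
    by (auto simp: string_tape_def)
  ultimately have len: "length \<sigma> = length \<sigma>'" by simp
  show ?thesis
  proof (rule nth_equalityI[OF len])
    fix i assume "i < length \<sigma>"
    then show "\<sigma> ! i = \<sigma>' ! i"
      using 1(2)[rule_format, of i] 2(2)[rule_format, of i] t len
      by (auto simp: string_tape_def)
  qed
qed

section \<open>Machines that print a fixed string\<close>

text \<open>State 0 loops unless the program is empty, which makes the domain \<open>{[]}\<close>
  and hence prefix-free. State \<open>j + 2\<close> prints bit \<open>j\<close>; state 1 is reserved
  for halting.\<close>

definition const_otm :: "bool list \<Rightarrow> otm" where
  "const_otm \<sigma> = \<lparr>num_states = length \<sigma> + 3, num_symbols = 3, num_tapes = 4,
     transition = (\<lambda>q xs.
       (if q = 0 then if xs ! 0 = 0 then 2 else 0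
        else if q - 2 < length \<sigma> then q + 1 else 1,
        [(xs ! 0, 0), (xs ! 1, 0), (xs ! 2, 0),
         if 2 \<le> q \<and> q - 2 < length \<sigma> then (bit_symbol (\<sigma> ! (q - 2)), 1) else (xs ! 3, 0)]))\<rparr>"

lemma const_otm_wf: "otm_wf (const_otm \<sigma>)"
proof -
  have "set xs \<subseteq> {..<3} \<Longrightarrow> length xs = 4 \<Longrightarrow> i < 4 \<Longrightarrow> xs ! i < 3" for xs :: "nat list" and i
    using nth_mem[of i xs] by (force dest: subsetD simp del: nth_mem)
  then show ?thesis
    by (auto simp: otm_wf_def const_otm_def bit_symbol_def)
qed

lemma const_otm_step:
  assumes "j < length \<sigma>"
  shows "otm_step (const_otm \<sigma>) (j + 2, h, t) =
    (j + 3, h(3 := h 3 + 1), t(3 := (t 3)(h 3 := bit_symbol (\<sigma> ! j))))"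
  using assms by (auto simp: otm_step_def const_otm_def fun_eq_iff nth_Cons' less_Suc_eq numeral_eq_Suc)

lemma const_otm_run:
  assumes "j \<le> length \<sigma>" "h 3 = int 0" "\<forall>z. t 3 z = 0"
  shows "\<exists>h' t'. (otm_step (const_otm \<sigma>) ^^ j) (2, h, t) = (j + 2, h', t') \<and> h' 3 = int j \<and>
    (\<forall>z. t' 3 z = string_tape (take j \<sigma>) z)"
  using assms(1)
proof (induction j)
  case 0
  then show ?case using assms by (auto simp: string_tape_def)
next
  case (Suc j)
  then obtain h' t' where IH: "(otm_step (const_otm \<sigma>) ^^ j) (2, h, t) = (j + 2, h', t')"
    "h' 3 = int j" "\<forall>z. t' 3 z = string_tape (take j \<sigma>) z" by auto
  from Suc.prems have "j < length \<sigma>" by simp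
  then show ?case
    using IH const_otm_step[of j \<sigma> h' t'] by (auto simp: string_tape_def nth_append take_Suc_conv_app_nth)
qed

lemma const_otm_computes: "otm_computes (const_otm \<sigma>) A [] \<tau> \<sigma>"
proof -
  let ?S = "otm_step (const_otm \<sigma>)"
  define c where "c = ?S (otm_init A [] \<tau>)"
  have "\<exists>h t. c = (2, h, t) \<and> h 3 = int 0 \<and> (\<forall>z. t 3 z = 0)"
    by (auto simp: c_def otm_step_def const_otm_def otm_init_def string_tape_def)
  then obtain h t where c: "c = (2, h, t)" "h 3 = int 0" "\<forall>z. t 3 z = 0" by blast
  obtain h' t' where run: "(?S ^^ length \<sigma>) c = (length \<sigma> + 2, h', t')"
    "\<forall>z. t' 3 z = string_tape \<sigma> z"
    using const_otm_run[of "length \<sigma>" \<sigma> h t] c by auto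
  obtain h'' t'' where fin: "?S (length \<sigma> + 2, h', t') = (1, h'', t'')" "t'' 3 = t' 3"
    by (simp add: otm_step_def const_otm_def)
  have "(?S ^^ (Suc (length \<sigma> + 1))) (otm_init A [] \<tau>) = (1, h'', t'')"
    using run(1) fin(1) unfolding c_def funpow.simps funpow_add by (simp add: funpow_swap1)
  then show ?thesis
    unfolding otm_computes_def using run(2) fin(2) by metis
qed

lemma const_otm_prefix_free: "prefix_free_otm (const_otm \<sigma>)"
proof -
  have stuck: "\<not> otm_computes (const_otm \<sigma>) A \<pi> \<tau> \<sigma>'" if "\<pi> \<noteq> []" for A \<pi> \<tau> \<sigma>'
  proof -
    have "fst ((otm_step (const_otm \<sigma>) ^^ n) (otm_init A \<pi> \<tau>)) = 0 \<and>
        fst (snd ((otm_step (const_otm \<sigma>) ^^ n) (otm_init A \<pi> \<tau>))) 0 = 0 \<and>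
        snd (snd ((otm_step (const_otm \<sigma>) ^^ n) (otm_init A \<pi> \<tau>))) 0 = string_tape \<pi>" for n
    proof (induction n)
      case 0
      then show ?case by (auto simp: otm_init_def)
    next
      case (Suc n)
      obtain q h t where c: "(otm_step (const_otm \<sigma>) ^^ n) (otm_init A \<pi> \<tau>) = (q, h, t)"
        by (metis prod_cases3)
      have "string_tape \<pi> 0 \<noteq> 0" using that by (auto simp: string_tape_def)
      then show ?case using Suc c
        by (auto simp: otm_step_def const_otm_def fun_eq_iff)
    qed
    then show ?thesis unfolding otm_computes_def by (metis fst_conv zero_neq_one)
  qed
  show ?thesis unfolding prefix_free_otm_def
    using const_otm_wf stuck[of _] by (metis prefix_Nil strict_prefix_def)
qed


section \<open>The table lookup machine\<close>

text \<open>The odd cells of the oracle tape list pairs of strings. The program looks for the first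
  listed key that is comparable with it, and fails unless this key is the program itself. This
  forces the domain to be prefix-free whatever the oracle is.

  Odd states skip an even cell of the oracle tape. Even states: 2, 4, 6 compare the key with the
  program, 8, 10, 12 skip the rest of the key, 18, 20, 22 skip the value, 24 rewinds the program,
  14, 16 copy the value to the output, 26 loops.\<close>

definition table_act :: "nat \<Rightarrow> nat \<Rightarrow> nat \<Rightarrow> nat \<Rightarrow> nat \<times> int \<times> int \<times> nat \<times> int" where
  "table_act q p b w =
    (if odd q then (q - 1, 0, 1, w, 0)
     else if q = 0 then (2, 0, 1, w, 0)
     else if q = 2 then (if b = 2 then 5 else 7, 0, 1, w, 0)
     else if q = 4 then
       if p = 0 then (26, 0, 0, w, 0) else if p = b then (3, 1, 1, w, 0) else (9, 0, 1, w, 0)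
     else if q = 6 then if p = 0 then (15, 0, 1, w, 0) else (26, 0, 0, w, 0)
     else if q = 8 then (if b = 2 then 11 else 13, 0, 1, w, 0)
     else if q = 10 then (9, 0, 1, w, 0)
     else if q = 12 then (19, 0, 1, w, 0)
     else if q = 14 then (if b = 2 then 17 else 1, 0, 1, w, 0)
     else if q = 16 then (15, 0, 1, b, 1)
     else if q = 18 then (if b = 2 then 21 else 23, 0, 1, w, 0)
     else if q = 20 then (19, 0, 1, w, 0)
     else if q = 22 then (25, 0, 1, w, 0)
     else if q = 24 then if p = 0 then (2, 1, 0, w, 0) else (24, -1, 0, w, 0)
     else (26, 0, 0, w, 0))"

definition table_otm :: otm where
  "table_otm = \<lparr>num_states = 27, num_symbols = 3, num_tapes = 4,
     transition = (\<lambda>q xs. case table_act q (xs ! 0) (xs ! 2) (xs ! 3) of (q', dp, db, w, dw) \<Rightarrow>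
       (q', [(xs ! 0, dp), (xs ! 1, 0), (xs ! 2, db), (w, dw)]))\<rparr>"

lemma table_otm_wf: "otm_wf table_otm"
proof -
  have x: "set xs \<subseteq> {..<3} \<Longrightarrow> length xs = 4 \<Longrightarrow> i < 4 \<Longrightarrow> xs ! i < 3" for xs :: "nat list" and i
    using nth_mem[of i xs] by (force dest: subsetD simp del: nth_mem)
  have act: "case table_act q p b w of (q', dp, db, w', dw) \<Rightarrow>
      q' < 27 \<and> dp \<in> {-1, 0, 1} \<and> db \<in> {-1, 0, 1} \<and> w' < 3 \<and> dw \<in> {-1, 0, 1}"
    if "q < 27" "b < 3" "w < 3" for q p b w
  proof -
    have "q - Suc 0 < 27" using that by simp
    then show ?thesis using that by (simp add: table_act_def)
  qed
  show ?thesis unfolding otm_wf_def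
  proof (intro conjI allI impI)
    fix q and xs :: "nat list"
    assume "q < num_states table_otm \<and> length xs = num_tapes table_otm
      \<and> set xs \<subseteq> {..<num_symbols table_otm}"
    then have "q < 27" "length xs = 4" "set xs \<subseteq> {..<3}" by (auto simp: table_otm_def)
    then show "case transition table_otm q xs of (q', acts) \<Rightarrow>
           q' < num_states table_otm \<and> length acts = num_tapes table_otm \<and>
           set acts \<subseteq> {..<num_symbols table_otm} \<times> {-1, 0, 1} \<and> fst (acts ! 2) = xs ! 2"
      using act[of q "xs ! 2" "xs ! 3" "xs ! 0"] x[of xs]
      by (auto simp: table_otm_def split: prod.splits)
  qed (auto simp: table_otm_def)
qed

text \<open>State, positions of the program, oracle and output heads, and the output tape. Nothing
  else changes during a run of \<open>table_otm\<close>.\<close>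

type_synonym table_config = "nat \<times> int \<times> int \<times> int \<times> (int \<Rightarrow> nat)"

definition table_step :: "bool list \<Rightarrow> nat set \<Rightarrow> table_config \<Rightarrow> table_config" where
  "table_step \<pi> Z = (\<lambda>(q, i, n, k, out). if q = 1 then (q, i, n, k, out) else
     case table_act q (string_tape \<pi> i) (oracle_tape Z n) (out k) of (q', dp, db, w, dw) \<Rightarrow>
       (q', i + dp, n + db, k + dw, out(k := w)))"

definition table_conf :: "bool list \<Rightarrow> bool list \<Rightarrow> nat set \<Rightarrow> table_config \<Rightarrow> otm_config" where
  "table_conf \<pi> \<tau> Z = (\<lambda>(q, i, n, k, out). (q, (\<lambda>_. 0)(0 := i, 2 := n, 3 := k),
     (\<lambda>_ _. 0)(0 := string_tape \<pi>, 1 := string_tape \<tau>, 2 := oracle_tape Z, 3 := out)))"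

lemma otm_step_table:
  "otm_step table_otm (table_conf \<pi> \<tau> Z c) = table_conf \<pi> \<tau> Z (table_step \<pi> Z c)"
proof -
  obtain q i n k out where c: "c = (q, i, n, k, out)" by (metis prod.exhaust)
  obtain q' dp db w dw where
    act: "table_act q (string_tape \<pi> i) (oracle_tape Z n) (out k) = (q', dp, db, w, dw)"
    by (metis prod.exhaust)
  have upt: "[0..<4] = [0, 1, 2, 3::nat]" by (simp add: upt_rec)
  have lt: "j < 4 \<longleftrightarrow> j = 0 \<or> j = 1 \<or> j = 2 \<or> j = 3" for j :: nat by auto
  show ?thesis
    using act by (auto simp: c otm_step_def table_step_def table_conf_def table_otm_def upt fun_eq_iff lt)
qed

lemma table_otm_computes:
  "otm_computes table_otm Z \<pi> \<tau> \<sigma> \<longleftrightarrow>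
     (\<exists>n i m k out. (table_step \<pi> Z ^^ n) (0, 0, 0, 0, \<lambda>_. 0) = (1, i, m, k, out) \<and>
        (\<forall>i\<le>length \<sigma>. out (int i) = string_tape \<sigma> (int i)))" (is "?L \<longleftrightarrow> ?R")
proof -
  have init: "otm_init Z \<pi> \<tau> = table_conf \<pi> \<tau> Z (0, 0, 0, 0, \<lambda>_. 0)"
    by (auto simp: otm_init_def table_conf_def fun_eq_iff)
  have run: "(otm_step table_otm ^^ n) (otm_init Z \<pi> \<tau>)
      = table_conf \<pi> \<tau> Z ((table_step \<pi> Z ^^ n) (0, 0, 0, 0, \<lambda>_. 0))" for n
    by (induction n) (simp_all add: init otm_step_table)
  show ?thesis
  proof
    assume ?L
    then obtain n h t where *: "table_conf \<pi> \<tau> Z ((table_step \<pi> Z ^^ n) (0, 0, 0, 0, \<lambda>_. 0)) = (1, h, t)"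
      "\<forall>i\<le>length \<sigma>. t 3 (int i) = string_tape \<sigma> (int i)"
      unfolding otm_computes_def run by blast
    obtain q i m k out where c: "(table_step \<pi> Z ^^ n) (0, 0, 0, 0, \<lambda>_. 0) = (q, i, m, k, out)"
      by (metis prod.exhaust)
    have "q = 1" "t 3 = out" using * unfolding c by (auto simp: table_conf_def)
    then show ?R using c * by blast
  next
    assume ?R
    then obtain n i m k out where c: "(table_step \<pi> Z ^^ n) (0, 0, 0, 0, \<lambda>_. 0) = (1, i, m, k, out)"
        "\<forall>i\<le>length \<sigma>. out (int i) = string_tape \<sigma> (int i)" by blast
    show ?L unfolding otm_computes_def run using c
      by (intro exI[of _ n]) (auto simp: table_conf_def)
  qed
qed

lemma table_halted: "(table_step \<pi> Z ^^ n) (1, c) = (1, c)"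
  by (induction n) (auto simp: table_step_def split: prod.splits)

text \<open>Runs on \<open>\<pi>\<close> and on a proper extension \<open>\<pi>'\<close> proceed in
  lockstep, since the program tapes agree left of cell \<open>length \<pi>\<close>. In that cell the
  symbol is consulted only in states 4 and 6, and there one of the runs enters the loop at 26. So
  they cannot both halt.\<close>

lemma table_otm_prefix_free: "prefix_free_otm table_otm"
proof -
  have False if comp: "otm_computes table_otm Z \<pi> \<tau> \<sigma>" "otm_computes table_otm Z \<pi>' \<tau> \<sigma>'"
    and pre: "strict_prefix \<pi> \<pi>'" for Z \<pi> \<tau> \<sigma> \<pi>' \<sigma>'
  proof -
    let ?c0 = "(0, 0, 0, 0, \<lambda>_. 0) :: table_config"
    obtain a v where \<pi>': "\<pi>' = \<pi> @ a # v" using pre by (auto elim: strict_prefixE')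
    have same: "string_tape \<pi>' z = string_tape \<pi> z" if "z < int (length \<pi>)" for z
      using that by (auto simp: string_tape_def \<pi>' nth_append)
    have nz: "string_tape \<pi> z \<noteq> 0" if "z < int (length \<pi>)" "0 \<le> z" for z
      using that by (auto simp: string_tape_def)
    have z: "string_tape \<pi> (int (length \<pi>)) = 0" "string_tape \<pi>' (int (length \<pi>)) \<noteq> 0"
      by (auto simp: string_tape_def \<pi>')
    \<comment> \<open>States 8 to 13 and 18 to 25 occur only after a mismatch with a bit of the
      program, hence with the head left of cell \<open>length \<pi>\<close>. Only the rewinding
      state 24 may visit cell -1.\<close>
    define I where "I = (\<lambda>c c' :: table_config. fst c = 26 \<or> fst c' = 26 \<or> c = c' \<and>
      -1 \<le> fst (snd c) \<and> fst (snd c) \<le> int (length \<pi>) \<and>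
      (fst c \<in> {0, 2, 3, 4, 5, 6, 7} \<or> 
       fst c \<in> {8, 9, 10, 11, 12, 13, 18, 19, 20, 21, 22, 23, 24, 25} \<and> fst (snd c) < int (length \<pi>)) \<and>
      (fst c = 24 \<or> 0 \<le> fst (snd c)))"
    have inv: "I ((table_step \<pi> Z ^^ n) ?c0) ((table_step \<pi>' Z ^^ n) ?c0)" for n
    proof (induction n)
      case 0
      then show ?case by (simp add: I_def)
    next
      case (Suc n)
      have loop: "fst c = 26 \<Longrightarrow> fst (table_step p Z c) = 26" for c p
        by (cases c) (auto simp: table_step_def table_act_def)
      have step: "I (table_step \<pi> Z c) (table_step \<pi>' Z c')" if "I c c'" for c c'
      proof (cases "fst c = 26 \<or> fst c' = 26")
        case True
        then have "fst (table_step \<pi> Z c) = 26 \<or> fst (table_step \<pi>' Z c') = 26"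
          using loop by blast
        then show ?thesis unfolding I_def by blast
      next
        case False
        obtain q i m k out where c: "c = (q, i, m, k, out)" by (metis prod.exhaust)
        have c': "c' = c" using that False by (auto simp: I_def)
        have *: "-1 \<le> i" "i \<le> int (length \<pi>)" "q = 24 \<or> 0 \<le> i"
          "q \<in> {0, 2, 3, 4, 5, 6, 7} \<or>
           q \<in> {8, 9, 10, 11, 12, 13, 18, 19, 20, 21, 22, 23, 24, 25} \<and> i < int (length \<pi>)"
          using that False by (auto simp: I_def c c')
        show ?thesis
        proof (cases "i < int (length \<pi>)")
          case True
          have "i = -1 \<and> string_tape \<pi> i = 0 \<or> 0 \<le> i \<and> string_tape \<pi> i \<noteq> 0"
            using nz[OF True] *(1) by (cases "i = -1") (auto simp: string_tape_def)
          then show ?thesis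
            using * True same[OF True]
            by (elim disjE conjE insertE emptyE)
              (simp_all add: I_def c c' table_step_def table_act_def)
        next
          case False
          then have "i = int (length \<pi>)" using * by simp
          then show ?thesis
            using * z
            by (elim disjE conjE insertE emptyE)
              (simp_all add: I_def c c' table_step_def table_act_def)
        qed
      qed
      show ?case using step[OF Suc] by simp
    qed
    obtain n c where 1: "(table_step \<pi> Z ^^ n) ?c0 = (1, c)"
      using comp(1) unfolding table_otm_computes by blast
    obtain n' c' where 2: "(table_step \<pi>' Z ^^ n') ?c0 = (1, c')"
      using comp(2) unfolding table_otm_computes by blast
    have "(table_step \<pi> Z ^^ (n' + n)) ?c0 = (1, c)"
      unfolding funpow_add comp_apply 1 by (rule table_halted)
    moreover have "(table_step \<pi>' Z ^^ (n' + n)) ?c0 = (1, c')"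
      unfolding add.commute[of n' n] funpow_add comp_apply 2 by (rule table_halted)
    ultimately have "I (1, c) (1, c')" using inv[of "n' + n"] by simp
    then show False by (simp add: I_def)
  qed
  then show ?thesis using table_otm_wf unfolding prefix_free_otm_def by blast
qed

section \<open>Tables of strings on the oracle tape\<close>

text \<open>A \<open>True\<close> announces a bit, and the end marker also has two cells, so the
  machine reads the table in blocks of two without knowing any length.\<close>

definition token_code :: "bool list \<Rightarrow> bool list" where
  "token_code w = concat (map (\<lambda>b. [True, b]) w) @ [False, False]"

definition entry_code :: "bool list \<times> bool list \<Rightarrow> bool list" where
  "entry_code e = token_code (fst e) @ token_code (snd e)"

text \<open>Positions refer to \<open>B\<close>; in the join with another oracle, position
  \<open>m\<close> is cell \<open>2 * m + 1\<close> of the oracle tape.\<close>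

definition carries :: "nat set \<Rightarrow> nat \<Rightarrow> bool list \<Rightarrow> bool" where
  "carries B m L \<longleftrightarrow> (\<forall>i<length L. m + i \<in> B \<longleftrightarrow> L ! i)"

lemma carries_Nil [simp]: "carries B m []"
  by (simp add: carries_def)

lemma carries_Cons [simp]: "carries B m (b # L) \<longleftrightarrow> (m \<in> B \<longleftrightarrow> b) \<and> carries B (Suc m) L"
proof -
  have "(\<forall>i<Suc (length L). P i) \<longleftrightarrow> P 0 \<and> (\<forall>i<length L. P (Suc i))" for P
    by (auto simp: less_Suc_eq_0_disj)
  then show ?thesis unfolding carries_def by simp
qed

lemma carries_append [simp]: "carries B m (L @ L') \<longleftrightarrow> carries B m L \<and> carries B (m + length L) L'"
  by (induction L arbitrary: m) simp_all

lemma token_code_simps [simp]: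
  "token_code [] = [False, False]" "token_code (b # w) = True # b # token_code w"
  by (simp_all add: token_code_def)

lemma length_token_code [simp]: "length (token_code w) = 2 * length w + 2"
  by (induction w) auto

lemma oracle_tape_join_odd:
  "oracle_tape (oracle_join A B) (2 * int m + 1) = bit_symbol (m \<in> B)"
proof -
  have "nat (2 * int m + 1) = Suc (2 * m)" by linarith
  moreover have "Suc (2 * m) \<noteq> 2 * x" for x by presburger
  then have "Suc (2 * m) \<in> oracle_join A B \<longleftrightarrow> m \<in> B"
    unfolding oracle_join_def by auto
  ultimately show ?thesis by (simp add: oracle_tape_def)
qed

fun write_out :: "(int \<Rightarrow> nat) \<Rightarrow> nat \<Rightarrow> bool list \<Rightarrow> int \<Rightarrow> nat" where
  "write_out out k [] = out"
| "write_out out k (b # v) = write_out (out(int k := bit_symbol b)) (Suc k) v"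

lemma write_out_nth:
  "write_out out k v (int j) = (if k \<le> j \<and> j < k + length v then bit_symbol (v ! (j - k)) else out (int j))"
  by (induction v arbitrary: out k) (auto simp: nth_Cons' not_less_eq_eq)

context
  fixes \<pi> :: "bool list" and A B :: "nat set"
begin

abbreviation (input) step :: "table_config \<Rightarrow> table_config" where
  "step \<equiv> table_step \<pi> (oracle_join A B)"

definition reach :: "table_config \<Rightarrow> table_config \<Rightarrow> bool" where
  "reach c c' \<longleftrightarrow> (\<exists>n. (step ^^ n) c = c')"

lemma reach_refl: "reach c c"
  unfolding reach_def by (rule exI[of _ 0]) simp

lemma reach_trans:
  assumes "reach c c'" "reach c' c''"
  shows "reach c c''"
proof -
  obtain m n where "(step ^^ m) c = c'" "(step ^^ n) c' = c''"
    using assms unfolding reach_def by blast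
  then have "(step ^^ (n + m)) c = c''" by (simp add: funpow_add)
  then show ?thesis unfolding reach_def by blast
qed

lemma reach_step:
  assumes "reach (step c) c'"
  shows "reach c c'"
proof -
  obtain m where "(step ^^ m) (step c) = c'" using assms unfolding reach_def by blast
  then have "(step ^^ Suc m) c = c'" by (simp add: funpow_swap1)
  then show ?thesis unfolding reach_def by blast
qed

text \<open>Apart from rewinding, a step on an odd oracle cell is followed by one that skips the
  next even cell, so runs are traced two steps at a time.\<close>

lemma reach_two: "step (step c) = c' \<Longrightarrow> reach c' c'' \<Longrightarrow> reach c c''"
  by (rule reach_step, rule reach_step) simp

lemmas step_simps = table_step_def table_act_def oracle_tape_join_odd

lemma reach_compare:
  assumes "carries B m (concat (map (\<lambda>b. [True, b]) w))" "take (length w) (drop i \<pi>) = w"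
  shows "reach (2, int i, 2 * int m + 1, k, out)
    (2, int (i + length w), 2 * int (m + 2 * length w) + 1, k, out)"
  using assms
proof (induction w arbitrary: i m)
  case Nil
  then show ?case by (simp add: reach_refl)
next
  case (Cons b w)
  then have i: "i < length \<pi>" by (cases "i < length \<pi>") auto
  then have b: "\<pi> ! i = b" "take (length w) (drop (Suc i) \<pi>) = w"
    using Cons.prems(2) by (auto simp flip: Cons_nth_drop_Suc)
  have p: "string_tape \<pi> (int i) = bit_symbol b" using i b by (simp add: string_tape_def)
  have 1: "step (step (2, int i, 2 * int m + 1, k, out)) = (4, int i, 2 * int (Suc m) + 1, k, out)"
    using Cons.prems(1) by (simp add: step_simps)
  have 2: "step (step (4, int i, 2 * int (Suc m) + 1, k, out)) =
      (2, int (Suc i), 2 * int (Suc (Suc m)) + 1, k, out)"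
    using Cons.prems(1) p oracle_tape_join_odd[of A B "Suc m"] by (simp add: table_step_def table_act_def)
  have 3: "reach (2, int (Suc i), 2 * int (Suc (Suc m)) + 1, k, out)
     (2, int (Suc i + length w), 2 * int (Suc (Suc m) + 2 * length w) + 1, k, out)"
    using Cons b i by (intro Cons.IH) auto
  show ?case using reach_two[OF 1 reach_two[OF 2 3]] by (simp add: add_ac)
qed

lemma reach_skip_key:
  assumes "carries B m (token_code w)"
  shows "reach (8, i, 2 * int m + 1, k, out) (18, i, 2 * int (m + length (token_code w)) + 1, k, out)"
  using assms
proof (induction w arbitrary: m)
  case Nil
  have 1: "step (step (8, i, 2 * int m + 1, k, out)) = (12, i, 2 * int (Suc m) + 1, k, out)"
    using Nil by (simp add: step_simps)
  have 2: "step (step (12, i, 2 * int (Suc m) + 1, k, out)) =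
      (18, i, 2 * int (Suc (Suc m)) + 1, k, out)"
    by (simp add: table_step_def table_act_def)
  show ?case using reach_two[OF 1 reach_two[OF 2 reach_refl]] by simp
next
  case (Cons b w)
  have 1: "step (step (8, i, 2 * int m + 1, k, out)) = (10, i, 2 * int (Suc m) + 1, k, out)"
    using Cons.prems(1) by (simp add: step_simps)
  have 2: "step (step (10, i, 2 * int (Suc m) + 1, k, out)) =
      (8, i, 2 * int (Suc (Suc m)) + 1, k, out)"
    by (simp add: table_step_def table_act_def)
  have 3: "reach (8, i, 2 * int (Suc (Suc m)) + 1, k, out)
     (18, i, 2 * int (Suc (Suc m) + length (token_code w)) + 1, k, out)"
    using Cons by (intro Cons.IH) auto
  show ?case using reach_two[OF 1 reach_two[OF 2 3]] by (simp add: add_ac)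
qed

lemma reach_skip_value:
  assumes "carries B m (token_code w)"
  shows "reach (18, i, 2 * int m + 1, k, out) (24, i, 2 * int (m + length (token_code w)) + 1, k, out)"
  using assms
proof (induction w arbitrary: m)
  case Nil
  have 1: "step (step (18, i, 2 * int m + 1, k, out)) = (22, i, 2 * int (Suc m) + 1, k, out)"
    using Nil by (simp add: step_simps)
  have 2: "step (step (22, i, 2 * int (Suc m) + 1, k, out)) =
      (24, i, 2 * int (Suc (Suc m)) + 1, k, out)"
    by (simp add: table_step_def table_act_def)
  show ?case using reach_two[OF 1 reach_two[OF 2 reach_refl]] by simp
next
  case (Cons b w)
  have 1: "step (step (18, i, 2 * int m + 1, k, out)) = (20, i, 2 * int (Suc m) + 1, k, out)"
    using Cons.prems(1) by (simp add: step_simps)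
  have 2: "step (step (20, i, 2 * int (Suc m) + 1, k, out)) =
      (18, i, 2 * int (Suc (Suc m)) + 1, k, out)"
    by (simp add: table_step_def table_act_def)
  have 3: "reach (18, i, 2 * int (Suc (Suc m)) + 1, k, out)
     (24, i, 2 * int (Suc (Suc m) + length (token_code w)) + 1, k, out)"
    using Cons by (intro Cons.IH) auto
  show ?case using reach_two[OF 1 reach_two[OF 2 3]] by (simp add: add_ac)
qed

lemma reach_rewind:
  assumes "i \<le> length \<pi>"
  shows "reach (24, int i - 1, n, k, out) (2, 0, n, k, out)"
  using assms
proof (induction i)
  case 0
  show ?case
    by (rule reach_step) (simp add: table_step_def table_act_def string_tape_def reach_refl)
next
  case (Suc i)
  then have "step (24, int (Suc i) - 1, n, k, out) = (24, int i - 1, n, k, out)"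
    by (simp add: table_step_def table_act_def string_tape_def)
  then show ?case using Suc reach_step[of "(24, int (Suc i) - 1, n, k, out)"] by simp
qed

lemma reach_next_entry:
  assumes "carries B m (entry_code (w, v))" "w \<parallel> \<pi>"
  shows "reach (2, 0, 2 * int m + 1, k, out)
    (2, 0, 2 * int (m + length (entry_code (w, v))) + 1, k, out)"
proof -
  \<comment> \<open>\<open>u\<close> is the longest common prefix. The comparison succeeds on
    \<open>u\<close> and fails on the next bits \<open>b\<close> and \<open>c\<close>; the rest of
    the entry is then skipped.\<close>
  obtain u b w' c \<pi>' where dec: "b \<noteq> c" "w = u @ b # w'" "\<pi> = u @ c # \<pi>'"
    using parallel_decomp[OF assms(2)] by blast
  have split: "token_code w = concat (map (\<lambda>b. [True, b]) u) @ token_code (b # w')"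
    by (simp add: token_code_def dec)
  have len: "length (concat (map (\<lambda>b. [True, b]) u)) = 2 * length u"
    by (induction u) auto
  let ?m = "m + 2 * length u"
  have "carries B m (token_code w)" and car3: "carries B (m + length (token_code w)) (token_code v)"
    using assms(1) unfolding entry_code_def fst_conv snd_conv carries_append by blast+
  then have car: "carries B m (concat (map (\<lambda>b. [True, b]) u))" "carries B ?m (token_code (b # w'))"
    unfolding split carries_append len by blast+
  have cmp: "reach (2, int 0, 2 * int m + 1, k, out) (2, int (0 + length u), 2 * int ?m + 1, k, out)"
    using car(1) by (intro reach_compare) (simp_all add: dec)
  have p: "string_tape \<pi> (int (length u)) = bit_symbol c"
    by (simp add: string_tape_def dec)
  have 1: "step (step (2, int (length u), 2 * int ?m + 1, k, out)) =
      (4, int (length u), 2 * int (Suc ?m) + 1, k, out)"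
    using car(2) oracle_tape_join_odd[of A B ?m] by (simp add: table_step_def table_act_def)
  have 2: "step (step (4, int (length u), 2 * int (Suc ?m) + 1, k, out)) =
      (8, int (length u), 2 * int (Suc (Suc ?m)) + 1, k, out)"
    using car(2) p dec(1) oracle_tape_join_odd[of A B "Suc ?m"]
    by (simp add: table_step_def table_act_def)
  have 3: "reach (8, int (length u), 2 * int (Suc (Suc ?m)) + 1, k, out)
      (18, int (length u), 2 * int (Suc (Suc ?m) + length (token_code w')) + 1, k, out)"
    using car(2) by (intro reach_skip_key) auto
  have "Suc (Suc ?m) + length (token_code w') = m + length (token_code w)"
    by (simp add: dec)
  then have 4: "reach (18, int (length u), 2 * int (Suc (Suc ?m) + length (token_code w')) + 1, k, out)
      (24, int (length u), 2 * int (m + length (token_code w) + length (token_code v)) + 1, k, out)"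
    using car3 by (simp only: reach_skip_value)
  have 5: "reach (24, int (length u), n, k, out) (2, 0, n, k, out)" for n
    using reach_rewind[of "Suc (length u)"] by (simp add: dec)
  have "reach (2, int (length u), 2 * int ?m + 1, k, out)
      (2, 0, 2 * int (m + length (token_code w) + length (token_code v)) + 1, k, out)"
    by (rule reach_two[OF 1 reach_two[OF 2 reach_trans[OF 3 reach_trans[OF 4 5]]]])
  then show ?thesis using reach_trans[OF cmp] by (simp add: entry_code_def add_ac)
qed

lemma reach_copy:
  assumes "carries B m (token_code v)"
  shows "\<exists>n'. reach (14, i, 2 * int m + 1, int k, out) (1, i, n', int (k + length v), write_out out k v)"
  using assms
proof (induction v arbitrary: m k out)
  case Nil
  then have "step (14, i, 2 * int m + 1, int k, out) = (1, i, 2 * int m + 2, int k, out)"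
    using oracle_tape_join_odd[of A B m] by (simp add: table_step_def table_act_def)
  then have "reach (14, i, 2 * int m + 1, int k, out) (1, i, 2 * int m + 2, int k, out)"
    by (metis reach_refl reach_step)
  then show ?case by auto
next
  case (Cons b v)
  let ?out = "out(int k := bit_symbol b)"
  have 1: "step (step (14, i, 2 * int m + 1, int k, out)) = (16, i, 2 * int (Suc m) + 1, int k, out)"
    using Cons.prems(1) by (simp add: step_simps)
  have 2: "step (step (16, i, 2 * int (Suc m) + 1, int k, out)) =
      (14, i, 2 * int (Suc (Suc m)) + 1, int (Suc k), ?out)"
    using Cons.prems(1) oracle_tape_join_odd[of A B "Suc m"] by (simp add: table_step_def table_act_def)
  have car: "carries B (Suc (Suc m)) (token_code v)" using Cons.prems by simp
  obtain n' where n': "reach (14, i, 2 * int (Suc (Suc m)) + 1, int (Suc k), ?out)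
      (1, i, n', int (Suc k + length v), write_out ?out (Suc k) v)"
    using Cons.IH[OF car, of "Suc k" ?out] by blast
  show ?case using reach_two[OF 1 reach_two[OF 2 n']] by auto
qed

text \<open>The end marker of the key is met exactly when the program head is on the blank behind
  \<open>\<pi>\<close>. State 6 accepts, and the value is copied.\<close>

lemma reach_match:
  assumes "carries B m (entry_code (\<pi>, v))"
  shows "\<exists>i n' k. reach (2, 0, 2 * int m + 1, 0, out) (1, i, n', k, write_out out 0 v)"
proof -
  let ?D = "concat (map (\<lambda>b. [True, b]) \<pi>)"
  have len: "length ?D = 2 * length \<pi>"
    by (induction \<pi>) auto
  let ?m = "m + 2 * length \<pi>"
  have "carries B m (token_code \<pi>)" and v: "carries B (m + length (token_code \<pi>)) (token_code v)"
    using assms unfolding entry_code_def fst_conv snd_conv carries_append by blast+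
  then have car: "carries B m ?D" "carries B ?m [False, False]"
    unfolding token_code_def carries_append len by blast+
  have cmp: "reach (2, int 0, 2 * int m + 1, 0, out)
      (2, int (0 + length \<pi>), 2 * int ?m + 1, 0, out)"
    using car(1) by (intro reach_compare) simp_all
  have p: "string_tape \<pi> (int (length \<pi>)) = 0"
    by (simp add: string_tape_def)
  have 1: "step (step (2, int (length \<pi>), 2 * int ?m + 1, 0, out)) =
      (6, int (length \<pi>), 2 * int (Suc ?m) + 1, 0, out)"
    using car(2) oracle_tape_join_odd[of A B ?m] by (simp add: table_step_def table_act_def)
  have 2: "step (step (6, int (length \<pi>), 2 * int (Suc ?m) + 1, 0, out)) =
      (14, int (length \<pi>), 2 * int (m + length (token_code \<pi>)) + 1, int 0, out)"
    using p by (simp add: table_step_def table_act_def)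
  obtain n' where 3: "reach (14, int (length \<pi>), 2 * int (m + length (token_code \<pi>)) + 1, int 0, out)
      (1, int (length \<pi>), n', int (0 + length v), write_out out 0 v)"
    using reach_copy[OF v] by blast
  show ?thesis
    using reach_trans[OF cmp, unfolded add_0, OF reach_two[OF 1 reach_two[OF 2 3]]] by auto
qed

end

definition table_prefix :: "(nat \<Rightarrow> bool list \<times> bool list) \<Rightarrow> nat \<Rightarrow> bool list" where
  "table_prefix f n = concat (map (\<lambda>i. entry_code (f i)) [0..<n])"

definition table_oracle :: "(nat \<Rightarrow> bool list \<times> bool list) \<Rightarrow> nat set" where
  "table_oracle f = {m. \<exists>n. m < length (table_prefix f n) \<and> table_prefix f n ! m}"

lemma table_prefix_mono: "n \<le> n' \<Longrightarrow> prefix (table_prefix f n) (table_prefix f n')"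
  unfolding table_prefix_def by (metis concat_append le_add_diff_inverse map_append prefixI upt_add_eq_append zero_le)

lemma table_oracle_nth:
  assumes "m < length (table_prefix f n)"
  shows "m \<in> table_oracle f \<longleftrightarrow> table_prefix f n ! m"
proof -
  have "table_prefix f n ! m = table_prefix f n' ! m" if "m < length (table_prefix f n')" for n'
    using table_prefix_mono[of n n' f] table_prefix_mono[of n' n f] assms that
    by (cases "n \<le> n'") (auto simp: prefix_def nth_append)
  then show ?thesis using assms unfolding table_oracle_def by blast
qed

lemma carries_table_oracle:
  "carries (table_oracle f) (length (table_prefix f n)) (entry_code (f n))"
proof -
  have eq: "table_prefix f (Suc n) = table_prefix f n @ entry_code (f n)"
    by (simp add: table_prefix_def)
  have "carries (table_oracle f) 0 (table_prefix f (Suc n))"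
    unfolding carries_def by (simp add: table_oracle_nth)
  then show ?thesis unfolding eq carries_append by simp
qed

text \<open>Each earlier entry is skipped after a mismatch and leaves the program head at 0 and the
  output tape blank.\<close>

lemma table_otm_lookup:
  assumes "f n = (\<pi>, v)" and "\<And>m. m < n \<Longrightarrow> fst (f m) \<parallel> \<pi>"
  shows "otm_computes table_otm (oracle_join A (table_oracle f)) \<pi> \<tau> v"
proof -
  let ?B = "table_oracle f"
  let ?P = "\<lambda>m. 2 * int (length (table_prefix f m)) + 1"
  have run: "reach \<pi> A ?B (0, 0, 0, 0, \<lambda>_. 0) (2, 0, ?P m, 0, \<lambda>_. 0)" if "m \<le> n" for m
    using that
  proof (induction m)
    case 0
    have "table_step \<pi> (oracle_join A ?B) (0, 0, 0, 0, \<lambda>_. 0) = (2, 0, 1, 0, \<lambda>_. 0)"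
      by (simp add: table_step_def table_act_def fun_eq_iff)
    then have "reach \<pi> A ?B (0, 0, 0, 0, \<lambda>_. 0) (2, 0, 1, 0, \<lambda>_. 0)"
      by (metis reach_step reach_refl)
    then show ?case by (simp add: table_prefix_def)
  next
    case (Suc m)
    obtain w u where fm: "f m = (w, u)" by fastforce
    have "length (table_prefix f (Suc m)) = length (table_prefix f m) + length (entry_code (w, u))"
      by (simp add: table_prefix_def fm)
    moreover have "w \<parallel> \<pi>" using assms(2)[of m] Suc.prems fm by simp
    ultimately show ?case
      using reach_trans[OF Suc.IH reach_next_entry[of ?B "length (table_prefix f m)" w u \<pi> A]]
        carries_table_oracle[of f m] Suc.prems fm by simp
  qed
  obtain i n' k where "reach \<pi> A ?B (2, 0, ?P n, 0, \<lambda>_. 0) (1, i, n', k, write_out (\<lambda>_. 0) 0 v)"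
    using reach_match[OF carries_table_oracle[of f n, unfolded assms(1)], of A "\<lambda>_. 0"]
    by (elim exE)
  then have "reach \<pi> A ?B (0, 0, 0, 0, \<lambda>_. 0) (1, i, n', k, write_out (\<lambda>_. 0) 0 v)"
    by (rule reach_trans[OF run[OF order_refl]])
  then obtain N where "(table_step \<pi> (oracle_join A ?B) ^^ N) (0, 0, 0, 0, \<lambda>_. 0) =
      (1, i, n', k, write_out (\<lambda>_. 0) 0 v)"
    unfolding reach_def by blast
  then show ?thesis
    unfolding table_otm_computes by (intro exI conjI) (auto simp: write_out_nth string_tape_def)
qed

lemma table_oracle_exists:
  fixes F :: "(bool list \<times> bool list) set"
  assumes "\<And>e e'. e \<in> F \<Longrightarrow> e' \<in> F \<Longrightarrow> prefix (fst e) (fst e') \<Longrightarrow> e = e'"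
  shows "\<exists>B. \<forall>A \<tau>. \<forall>(w, v)\<in>F. otm_computes table_otm (oracle_join A B) w \<tau> v"
proof (cases "F = {}")
  case False
  define f where "f = from_nat_into F"
  have rng: "range f = F" unfolding f_def using False by (intro range_from_nat_into) auto
  have "otm_computes table_otm (oracle_join A (table_oracle f)) w \<tau> v" if e: "(w, v) \<in> F" for A \<tau> w v
  proof -
    \<comment> \<open>The enumeration of a finite \<open>F\<close> repeats entries. Before the first
      index of \<open>(w, v)\<close> all entries differ from it, so their keys are incomparable with
      \<open>w\<close>.\<close>
    define n where "n = (LEAST n. f n = (w, v))"
    have "\<exists>n. f n = (w, v)" using e rng by (metis imageE)
    then have n: "f n = (w, v)" unfolding n_def by (rule LeastI_ex)
    have par: "fst (f m) \<parallel> w" if "m < n" for m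
    proof
      have "f m \<noteq> (w, v)" using not_less_Least that unfolding n_def by blast
      moreover have "f m \<in> F" using rng by blast
      ultimately show "\<not> prefix (fst (f m)) w" "\<not> prefix w (fst (f m))"
        using assms[of "f m" "(w, v)"] assms[of "(w, v)" "f m"] e by auto
    qed
    show ?thesis using n par by (rule table_otm_lookup[where f = f and n = n])
  qed
  then show ?thesis by blast
qed auto


section \<open>Encodings and complexity\<close>

lemma binary_digits_inj: "binary_digits a = binary_digits b \<Longrightarrow> a = b"
proof (induction a arbitrary: b rule: binary_digits.induct)
  case (1 n)
  show ?case
  proof (cases "n = 0 \<or> b = 0")
    case True
    then show ?thesis using "1.prems" by (auto simp: binary_digits.simps[of n] binary_digits.simps[of b] split: if_splits)
  next
    case False
    then have "odd n = odd b" "binary_digits (n div 2) = binary_digits (b div 2)"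
      using "1.prems" by (simp_all add: binary_digits.simps[of n] binary_digits.simps[of b])
    moreover from this have "n div 2 = b div 2" using "1.IH" False by blast
    ultimately show ?thesis by presburger
  qed
qed

lemma doubled_append_inj:
  "concat (map (\<lambda>b. [b, b]) xs) @ [False, True] @ u = concat (map (\<lambda>b. [b, b]) ys) @ [False, True] @ v \<Longrightarrow>
    xs = ys \<and> u = v"
proof (induction xs arbitrary: ys)
  case Nil
  then show ?case by (cases ys) auto
next
  case (Cons x xs)
  then show ?case by (cases ys) auto
qed

lemma encode_nat_append_inj: "encode_nat a @ u = encode_nat b @ v \<Longrightarrow> a = b \<and> u = v"
  using doubled_append_inj[of "binary_digits a" u "binary_digits b" v] binary_digits_inj
  by (auto simp: encode_nat_def)

lemma encode_rat_append_inj: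
  assumes "encode_rat p @ u = encode_rat q @ v"
  shows "p = q \<and> u = v"
proof -
  obtain a b where p: "quotient_of p = (a, b)" by fastforce
  obtain c d where q: "quotient_of q = (c, d)" by fastforce
  have eq: "(a < 0) = (c < 0)"
    "encode_nat (nat \<bar>a\<bar>) @ (encode_nat (nat b) @ u) = encode_nat (nat \<bar>c\<bar>) @ (encode_nat (nat d) @ v)"
    using assms by (simp_all add: encode_rat_def p q)
  then have "nat \<bar>a\<bar> = nat \<bar>c\<bar>" "encode_nat (nat b) @ u = encode_nat (nat d) @ v"
    using encode_nat_append_inj by blast+
  moreover from this have "nat b = nat d" "u = v" using encode_nat_append_inj by blast+
  moreover have "b > 0" "d > 0" using p q quotient_of_denom_pos by blast+
  ultimately have "a = c" "b = d" "u = v" using eq(1) by auto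
  then show ?thesis using p q quotient_of_inject by metis
qed

lemma encode_rat_vec_inj:
  fixes p q :: "rat ^ 'n::{finite,linorder}"
  assumes "encode_rat_vec p = encode_rat_vec q"
  shows "p = q"
proof -
  have "\<forall>i\<in>set xs. p $ i = q $ i"
    if "concat (map (\<lambda>i. encode_rat (p $ i)) xs) = concat (map (\<lambda>i. encode_rat (q $ i)) xs)" for xs
    using that by (induction xs) (auto dest!: encode_rat_append_inj)
  then show ?thesis using assms unfolding encode_rat_vec_def by (auto simp: vec_eq_iff)
qed

definition real_vec :: "rat ^ 'n \<Rightarrow> real ^ 'n" where
  "real_vec p = (\<chi> i. of_rat (p $ i))"

lemma real_vec_inj: "real_vec p = real_vec q \<longleftrightarrow> p = q"
  by (auto simp: real_vec_def vec_eq_iff)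

definition points :: "otm \<Rightarrow> nat set \<Rightarrow> nat \<Rightarrow> (real ^ 'n::{finite,linorder}) set" where
  "points U A k = real_vec ` {p. complexity U A (encode_rat_vec p) \<le> k}"

lemma complexity_le: "otm_computes U A \<pi> [] \<sigma> \<Longrightarrow> complexity U A \<sigma> \<le> length \<pi>"
  unfolding complexity_def by (rule Least_le) blast

lemma complexity_at_le:
  assumes "dist x (real_vec p) < 1 / 2 ^ r"
  shows "complexity_at U A r x \<le> complexity U A (encode_rat_vec p)"
  unfolding complexity_at_def
  by (rule Least_le) (use assms in \<open>auto simp: real_vec_def intro!: exI[of _ p]\<close>)

lemma real_vec_dense:
  fixes x :: "real ^ 'n"
  assumes "0 < \<epsilon>"
  shows "\<exists>p. dist x (real_vec p) < \<epsilon>"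
proof -
  let ?d = "\<epsilon> / real CARD('n)"
  have d: "?d > 0" using assms by simp
  have "\<exists>q. x $ i < of_rat q \<and> of_rat q < x $ i + ?d" for i
    using of_rat_dense[of "x $ i" "x $ i + ?d"] d by auto
  then obtain p where p: "x $ i < of_rat (p i)" "of_rat (p i) < x $ i + ?d" for i by metis
  have "dist x (real_vec (\<chi> i. p i)) \<le> (\<Sum>i\<in>UNIV. \<bar>(x - real_vec (\<chi> i. p i)) $ i\<bar>)"
    unfolding dist_norm by (rule norm_le_l1_cart)
  also have "\<dots> < (\<Sum>i\<in>(UNIV :: 'n set). ?d)"
  proof (rule sum_strict_mono)
    fix i show "\<bar>(x - real_vec (\<chi> i. p i)) $ i\<bar> < ?d"
      using p(1)[of i] p(2)[of i] by (simp add: real_vec_def)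
  qed auto
  also have "\<dots> = \<epsilon>" by simp
  finally show ?thesis by blast
qed

context
  fixes U :: otm
  assumes U: "universal_prefix_free_otm U"
begin

text \<open>Simulating \<open>const_otm \<sigma>\<close>, the machine \<open>U\<close> has a program
  for every string under every oracle, so the \<open>LEAST\<close> in \<open>complexity\<close>
  ranges over a nonempty set.\<close>

lemma complexity_attained: "\<exists>\<pi>. length \<pi> = complexity U A \<sigma> \<and> otm_computes U A \<pi> [] \<sigma>"
proof -
  obtain \<rho> where "\<And>A \<pi> \<tau> \<sigma>'. otm_computes U A (\<rho> @ \<pi>) \<tau> \<sigma>' \<longleftrightarrow> otm_computes (const_otm \<sigma>) A \<pi> \<tau> \<sigma>'"
    using U const_otm_prefix_free[of \<sigma>] unfolding universal_prefix_free_otm_def by blast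
  then have "otm_computes U A (\<rho> @ []) [] \<sigma>" using const_otm_computes by blast
  then have "\<exists>l \<pi>. length \<pi> = l \<and> otm_computes U A \<pi> [] \<sigma>" by blast
  then show ?thesis unfolding complexity_def by (rule LeastI_ex)
qed

lemma
  shows finite_points: "finite (points U A k :: (real ^ 'n::{finite,linorder}) set)"
    and card_points: "card (points U A k :: (real ^ 'n::{finite,linorder}) set) \<le> 2 ^ (k + 1)"
proof -
  let ?L = "{\<pi> :: bool list. set \<pi> \<subseteq> UNIV \<and> length \<pi> \<le> k}"
  obtain prog where prog: "length (prog \<sigma>) = complexity U A \<sigma>" "otm_computes U A (prog \<sigma>) [] \<sigma>" for \<sigma>
    using complexity_attained[of A] by metis
  let ?P = "{p :: rat ^ 'n::{finite,linorder}. complexity U A (encode_rat_vec p) \<le> k}"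
  \<comment> \<open>A shortest program determines its output, and the output determines the
    point.\<close>
  have inj: "inj_on (\<lambda>p. prog (encode_rat_vec p)) ?P"
  proof (rule inj_onI)
    fix p q :: "rat ^ 'n::{finite,linorder}" assume "prog (encode_rat_vec p) = prog (encode_rat_vec q)"
    then have "encode_rat_vec p = encode_rat_vec q"
      using prog(2) otm_computes_unique by metis
    then show "p = q" by (rule encode_rat_vec_inj)
  qed
  have sub: "(\<lambda>p. prog (encode_rat_vec p)) ` ?P \<subseteq> ?L" using prog(1) by auto
  have fin: "finite ?L" by (rule finite_lists_length_le) simp
  have P: "finite ?P" using inj_on_finite[OF inj sub fin] .
  then show "finite (points U A k :: (real ^ 'n::{finite,linorder}) set)" by (simp add: points_def)
  have "card ?P \<le> card ?L" using card_inj_on_le[OF inj sub fin] .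
  also have "card ?L = (\<Sum>i\<le>k. 2 ^ i)" by (subst card_lists_length_le) simp_all
  also have "\<dots> \<le> 2 ^ (k + 1)" by (induction k) auto
  finally show "card (points U A k :: (real ^ 'n::{finite,linorder}) set) \<le> 2 ^ (k + 1)"
    using card_image_le[OF P, of real_vec] by (simp add: points_def)
qed

lemma complexity_at_attained:
  "\<exists>y\<in>points U A (complexity_at U A r x). dist x y < 1 / 2 ^ r"
proof -
  obtain p where "dist x (real_vec p) < 1 / 2 ^ r" using real_vec_dense[of "1 / 2 ^ r" x] by auto
  then have "\<exists>l p. (\<chi> i. of_rat (p $ i)) \<in> ball x (1 / 2 ^ r) \<and> l = complexity U A (encode_rat_vec p)"
    unfolding real_vec_def by auto
  then have "\<exists>p. (\<chi> i. of_rat (p $ i)) \<in> ball x (1 / 2 ^ r) \<and>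
      complexity_at U A r x = complexity U A (encode_rat_vec p)"
    unfolding complexity_at_def by (rule LeastI_ex)
  then show ?thesis unfolding points_def real_vec_def by fastforce
qed

end


section \<open>Coding by tables\<close>

lemma prefix_unary:
  "prefix (replicate a True @ False # u) (replicate b True @ False # v) \<Longrightarrow> a = b \<and> prefix u v"
proof (induction a arbitrary: b)
  case 0
  then show ?case by (cases b) auto
next
  case (Suc a)
  then show ?case by (cases b) auto
qed

text \<open>The key of a point of \<open>S l\<close> consists of \<open>l div m\<close> and \<open>l mod m\<close> in unary, followed by \<open>l\<close> bits.\<close>

lemma table_coding:
  fixes S :: "nat \<Rightarrow> (real ^ 'n::{finite,linorder}) set"
  assumes U: "universal_prefix_free_otm U"
    and S: "\<And>l. finite (S l)" "\<And>l. card (S l) \<le> 2 ^ l" "\<And>l. S l \<subseteq> range real_vec"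
    and m: "0 < m"
  shows "\<exists>B c. \<forall>A l y r x. y \<in> S l \<longrightarrow> dist x y < 1 / 2 ^ r \<longrightarrow>
    complexity_at U (oracle_join A B) r x \<le> l + l div m + c"
proof -
  have "\<exists>f. inj_on f (S l) \<and> f ` S l \<subseteq> {w :: bool list. length w = l}" for l
  proof -
    have "card {w :: bool list. length w = l} = 2 ^ l"
      using card_lists_length_eq[of "UNIV :: bool set" l] by simp
    moreover have "finite {w :: bool list. length w = l}"
      using finite_lists_length_eq[of "UNIV :: bool set" l] by simp
    ultimately have "\<exists>f. f ` S l \<subseteq> {w :: bool list. length w = l} \<and> inj_on f (S l)"
      using S(1,2)[of l] by (intro card_le_inj) simp_all
    then show ?thesis by blast
  qed
  then obtain f where f: "\<And>l. inj_on (f l) (S l)" "\<And>l y. y \<in> S l \<Longrightarrow> length (f l y :: bool list) = l"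
    by (metis (mono_tags, lifting) image_subset_iff mem_Collect_eq)
  define code where "code = (\<lambda>l y. replicate (l div m) True @ False # replicate (l mod m) True @ False # f l y)"
  define F where "F = {(code l (real_vec p), encode_rat_vec p) | l p. real_vec p \<in> S l}"
  have "e = e'" if eF: "e \<in> F" "e' \<in> F" "prefix (fst e) (fst e')" for e e'
  proof -
    obtain l p where e: "e = (code l (real_vec p), encode_rat_vec p)" "real_vec p \<in> S l"
      using eF(1) unfolding F_def by blast
    obtain l' q where e': "e' = (code l' (real_vec q), encode_rat_vec q)" "real_vec q \<in> S l'"
      using eF(2) unfolding F_def by blast
    \<comment> \<open>The unary parts of the two keys are equal and determine \<open>l\<close>. The
      remaining strings then have the same length, so a prefix is an equality.\<close>
    have pre: "l div m = l' div m \<and> l mod m = l' mod m \<and> prefix (f l (real_vec p)) (f l' (real_vec q))"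
      using that(3) unfolding e(1) e'(1) code_def fst_conv by (meson prefix_unary)
    then have "l = l'" by (metis mult_div_mod_eq)
    moreover from this pre have "f l (real_vec p) = f l (real_vec q)"
      using f(2)[OF e(2)] f(2)[OF e'(2)] by (auto simp: prefix_def)
    ultimately have "real_vec p = real_vec q" using f(1)[of l] e(2) e'(2) by (auto dest: inj_onD)
    then show ?thesis using e e' \<open>l = l'\<close> by (simp add: real_vec_inj)
  qed
  then obtain B where B: "\<And>A \<tau> w v. (w, v) \<in> F \<Longrightarrow> otm_computes table_otm (oracle_join A B) w \<tau> v"
    using table_oracle_exists[of F] by blast
  obtain \<rho> where \<rho>: "\<And>A \<pi> \<tau> \<sigma>. otm_computes U A (\<rho> @ \<pi>) \<tau> \<sigma> \<longleftrightarrow> otm_computes table_otm A \<pi> \<tau> \<sigma>"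
    using U table_otm_prefix_free unfolding universal_prefix_free_otm_def by blast
  have "complexity_at U (oracle_join A B) r x \<le> l + l div m + (m + 2 + length \<rho>)"
    if "y \<in> S l" "dist x y < 1 / 2 ^ r" for A l y r x
  proof -
    obtain p where p: "y = real_vec p" using S(3)[of l] \<open>y \<in> S l\<close> by blast
    have "(code l y, encode_rat_vec p) \<in> F" using that(1) p unfolding F_def by blast
    then have "otm_computes U (oracle_join A B) (\<rho> @ code l y) [] (encode_rat_vec p)"
      using B \<rho> by blast
    then have "complexity U (oracle_join A B) (encode_rat_vec p) \<le> length \<rho> + length (code l y)"
      using complexity_le by fastforce
    moreover have "length (code l y) \<le> l + l div m + (m + 2)"
      using f(2)[OF that(1)] mod_less_divisor[OF m, of l] unfolding code_def by (simp del: mod_less_divisor)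
    ultimately show ?thesis using complexity_at_le[of x p r U "oracle_join A B"] that(2) p by simp
  qed
  then show ?thesis by blast
qed

text \<open>The bounds are geometric in \<open>r\<close>, so the union over all \<open>r\<close> of
  the sets \<open>S r l\<close> has at most \<open>2 ^ (l + c0)\<close> elements. One table
  therefore serves all \<open>r\<close>, and its keys do not record \<open>r\<close>.\<close>

lemma table_coding_powr:
  fixes S :: "nat \<Rightarrow> nat \<Rightarrow> (real ^ 'n::{finite,linorder}) set"
  assumes U: "universal_prefix_free_otm U"
    and S: "\<And>r l. finite (S r l)" "\<And>r l. S r l \<subseteq> range real_vec"
      "\<And>r l. real (card (S r l)) \<le> C * 2 powr (real l - \<eta> * real r)"
    and pos: "0 < \<eta>" "0 < \<theta>"
  shows "\<exists>B c. \<forall>A r l y \<rho> x. y \<in> S r l \<longrightarrow> dist x y < 1 / 2 ^ \<rho> \<longrightarrow>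
    real (complexity_at U (oracle_join A B) \<rho> x) \<le> (1 + \<theta>) * real l + c"
proof -
  define q where "q = 2 powr (- \<eta>)"
  have q: "0 < q" "q < 1" using pos by (auto simp: q_def powr_less_one)
  have powr: "C * 2 powr (real l - \<eta> * real r) = C * 2 ^ l * q ^ r" for l r
    by (simp add: q_def powr_diff powr_realpow powr_power powr_minus_divide power_divide
        flip: powr_realpow powr_powr)
  have C: "0 \<le> C" using S(3)[of 0 0] by (simp add: order_trans[OF of_nat_0_le_iff])
  obtain c0 where c0: "C * (1 / (1 - q)) \<le> 2 ^ c0"
    using real_arch_pow[of 2 "C * (1 / (1 - q))"] by (metis less_imp_le one_less_numeral_iff semiring_norm(76))
  have fin: "finite {r. S r l \<noteq> {}}" for l
  proof -
    have "(\<lambda>r. C * 2 ^ l * q ^ r) \<longlonglongrightarrow> C * 2 ^ l * 0"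
      using q by (intro tendsto_intros LIMSEQ_power_zero) auto
    then have "\<forall>\<^sub>F r in sequentially. C * 2 ^ l * q ^ r < 1"
      by (rule order_tendstoD) simp
    then obtain R where R: "\<And>r. r \<ge> R \<Longrightarrow> C * 2 ^ l * q ^ r < 1"
      unfolding eventually_sequentially by blast
    have "S r l = {}" if "r \<ge> R" for r
    proof -
      have "real (card (S r l)) < 1" using S(3)[of r l] R[OF that] powr by simp
      then show ?thesis using S(1)[of r l] by simp
    qed
    then have "{r. S r l \<noteq> {}} \<subseteq> {..<R}" by force
    then show ?thesis using finite_subset by blast
  qed
  \<comment> \<open>Shifting the index by \<open>c0\<close> absorbs the constant
    \<open>C / (1 - q)\<close>.\<close>
  define T where "T = (\<lambda>l. if l < c0 then {} else (\<Union>r. S r (l - c0)))"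
  have Un: "(\<Union>r. S r l) = (\<Union>r\<in>{r. S r l \<noteq> {}}. S r l)" for l by auto
  have T1: "finite (T l)" for l unfolding T_def Un using fin S(1) by auto
  have T2: "card (T l) \<le> 2 ^ l" for l
  proof (cases "l < c0")
    case False
    define k where "k = l - c0"
    have "real (card (T l)) \<le> (\<Sum>r\<in>{r. S r k \<noteq> {}}. real (card (S r k)))"
      unfolding T_def Un using False card_UN_le[OF fin[of k], of "\<lambda>r. S r k"]
      by (simp add: k_def flip: of_nat_sum)
    also have "\<dots> \<le> (\<Sum>r\<in>{r. S r k \<noteq> {}}. C * 2 ^ k * q ^ r)"
      using S(3) powr by (intro sum_mono) simp
    also have "\<dots> = C * 2 ^ k * (\<Sum>r\<in>{r. S r k \<noteq> {}}. q ^ r)"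
      by (simp add: sum_distrib_left)
    also have "\<dots> \<le> C * 2 ^ k * (\<Sum>r. q ^ r)"
      using q C fin by (intro mult_left_mono sum_le_suminf summable_geometric) auto
    also have "\<dots> = 2 ^ k * (C * (1 / (1 - q)))"
      using q by (subst suminf_geometric) auto
    also have "\<dots> \<le> 2 ^ k * 2 ^ c0" using c0 by (intro mult_left_mono) simp_all
    also have "\<dots> = 2 ^ l" using False by (simp add: k_def flip: power_add)
    finally have "real (card (T l)) \<le> real (2 ^ l)" by simp
    then show ?thesis by (simp only: of_nat_le_iff)
  qed (simp add: T_def)
  have T3: "T l \<subseteq> range real_vec" for l unfolding T_def using S(2) by auto
  \<comment> \<open>For such \<open>m\<close> the unary part \<open>l div m\<close> of a key costs
    at most \<open>\<theta> * l\<close>.\<close>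
  obtain m :: nat where m: "0 < m" "1 / real m \<le> \<theta>"
    using pos(2) by (metis ex_inverse_of_nat_less inverse_eq_divide less_imp_le)
  obtain B c where B: "\<And>A l y r x. y \<in> T l \<Longrightarrow> dist x y < 1 / 2 ^ r \<Longrightarrow>
    complexity_at U (oracle_join A B) r x \<le> l + l div m + c"
    using table_coding[OF U T1 T2 T3 m(1)] by blast
  have "real (complexity_at U (oracle_join A B) \<rho> x) \<le> (1 + \<theta>) * real l + ((1 + \<theta>) * real c0 + real c)"
    if "y \<in> S r l" "dist x y < 1 / 2 ^ \<rho>" for A r l y \<rho> x
  proof -
    have "y \<in> T (l + c0)" using that(1) by (auto simp: T_def)
    then have "complexity_at U (oracle_join A B) \<rho> x \<le> (l + c0) + (l + c0) div m + c"
      using B that(2) by blast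
    then have "real (complexity_at U (oracle_join A B) \<rho> x) \<le> real (l + c0) + real ((l + c0) div m) + real c"
      by linarith
    also have "real ((l + c0) div m) \<le> real (l + c0) * (1 / real m)"
      using of_nat_div_le_of_nat[where 'a = real, of "l + c0" m] by simp
    also have "\<dots> \<le> real (l + c0) * \<theta>" using m by (intro mult_left_mono) auto
    finally show ?thesis by (simp add: algebra_simps)
  qed
  then show ?thesis by blast
qed


section \<open>Null sets of Hausdorff measures and covers\<close>

text \<open>Diameters are not restricted here, in contrast to \<open>hausdorff_content\<close>: for
  \<open>0 < s\<close> a small sum makes every single diameter small.\<close>

definition covered :: "real \<Rightarrow> 'a::metric_space set \<Rightarrow> ennreal \<Rightarrow> bool" where
  "covered s D a \<longleftrightarrow> (\<exists>C :: nat \<Rightarrow> 'a set. D \<subseteq> (\<Union>i. C i) \<and> (\<forall>i. bounded (C i)) \<and>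
     (\<Sum>i. ennreal (diameter (C i) powr s)) \<le> a)"

lemma covered_mono: "covered s D a \<Longrightarrow> D' \<subseteq> D \<Longrightarrow> a \<le> b \<Longrightarrow> covered s D' b"
  unfolding covered_def by (meson order_trans)

lemma covered_UN:
  fixes D :: "nat \<Rightarrow> 'a::metric_space set"
  assumes "\<And>n. covered s (D n) (a n)"
  shows "covered s (\<Union>n. D n) (\<Sum>n. a n)"
proof -
  obtain C where C: "\<And>n. D n \<subseteq> (\<Union>i. C n i)" "\<And>n i. bounded (C n i)"
    "\<And>n. (\<Sum>i. ennreal (diameter (C n i) powr s)) \<le> a n"
    using assms unfolding covered_def by metis
  let ?C = "\<lambda>k. case prod_decode k of (n, i) \<Rightarrow> C n i"
  let ?f = "\<lambda>(n, i). ennreal (diameter (C n i) powr s)"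
  have "(\<Sum>k. ennreal (diameter (?C k) powr s)) = (\<Sum>k. ?f (prod_decode k))"
    by (rule arg_cong[where f = suminf]) (simp add: fun_eq_iff split: prod.split)
  also have "\<dots> = (\<Sum>n. \<Sum>i. ?f (n, i))"
    by (rule suminf_ennreal_2dimen[where f = ?f]) (rule refl)
  also have "\<dots> \<le> (\<Sum>n. a n)" using C(3) by (intro suminf_le) auto
  finally have "(\<Sum>k. ennreal (diameter (?C k) powr s)) \<le> (\<Sum>n. a n)" .
  moreover have "(\<Union>n. D n) \<subseteq> (\<Union>k. ?C k)"
  proof
    fix x assume "x \<in> (\<Union>n. D n)"
    then obtain n i where "x \<in> C n i" using C(1) by blast
    then have "x \<in> ?C (prod_encode (n, i))" by simp
    then show "x \<in> (\<Union>k. ?C k)" by (rule UN_I[where B = ?C, OF UNIV_I])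
  qed
  moreover have "bounded (?C k)" for k using C(2) by (auto split: prod.split)
  ultimately show ?thesis unfolding covered_def by (intro exI[of _ ?C]) blast
qed

lemma covered_empty: "covered s {} 0"
  unfolding covered_def by (intro exI[of _ "\<lambda>_. {}"]) auto

lemma covered_finite_UN:
  assumes "finite I" "\<And>i. i \<in> I \<Longrightarrow> covered s (D i) (a i)"
  shows "covered s (\<Union>i\<in>I. D i) (\<Sum>i\<in>I. a i)"
  using assms
proof (induction I rule: finite_induct)
  case empty
  then show ?case by (simp add: covered_empty)
next
  case (insert j I)
  let ?D = "\<lambda>n :: nat. if n = 0 then D j else if n = 1 then (\<Union>i\<in>I. D i) else {}"
  let ?a = "\<lambda>n :: nat. if n = 0 then a j else if n = 1 then (\<Sum>i\<in>I. a i) else 0"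
  have 0: "covered s (?D n) (?a n)" for n using insert covered_empty[of s] by auto
  have 1: "covered s (\<Union>n. ?D n) (\<Sum>n. ?a n)" by (rule covered_UN[of s ?D ?a]) (rule 0)
  have "(\<Sum>n. ?a n) = (\<Sum>n\<in>{0, 1}. ?a n)" by (rule suminf_finite) auto
  then have 2: "(\<Sum>n. ?a n) \<le> (\<Sum>i\<in>insert j I. a i)" using insert by simp
  have "(\<Union>i\<in>insert j I. D i) \<subseteq> (\<Union>n. ?D n)"
  proof
    fix x assume "x \<in> (\<Union>i\<in>insert j I. D i)"
    then have "x \<in> ?D 0 \<or> x \<in> ?D 1" by auto
    then show "x \<in> (\<Union>n. ?D n)" using UN_I[where B = ?D, OF UNIV_I] by blast
  qed
  then show ?case using covered_mono[OF 1] 2 by blast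
qed

lemma covered_bounded:
  assumes "bounded D"
  shows "covered s D (ennreal (diameter D powr s))"
proof -
  let ?C = "\<lambda>n :: nat. if n = 0 then D else {}"
  have "(\<Sum>n. ennreal (diameter (?C n) powr s)) = (\<Sum>n\<in>{0}. ennreal (diameter (?C n) powr s))"
    by (rule suminf_finite) auto
  then have "(\<Sum>n. ennreal (diameter (?C n) powr s)) \<le> ennreal (diameter D powr s)" by simp
  moreover have "D \<subseteq> (\<Union>n. ?C n)" using UN_upper[of 0 UNIV ?C] by simp
  moreover have "\<forall>n. bounded (?C n)" using assms by simp
  ultimately show ?thesis unfolding covered_def by (intro exI[of _ ?C] conjI)
qed

lemma hausdorff_measure_0:
  fixes D :: "'a::metric_space set"
  assumes "0 < s" and "\<And>\<gamma>. 0 < \<gamma> \<Longrightarrow> covered s D (ennreal \<gamma>)"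
  shows "hausdorff_measure s D = 0"
proof -
  have *: "hausdorff_content \<delta> s D \<le> 0 + ennreal \<gamma>" if "0 < \<delta>" "0 < \<gamma>" for \<delta> \<gamma>
  proof -
    \<comment> \<open>A sum of at most \<open>\<delta> powr s\<close> bounds each diameter by
      \<open>\<delta>\<close>, so the cover is admissible for
      \<open>hausdorff_content \<delta>\<close>.\<close>
    let ?\<gamma> = "min \<gamma> (\<delta> powr s)"
    have pos: "0 < ?\<gamma>" using that by simp
    obtain C :: "nat \<Rightarrow> 'a set" where C: "D \<subseteq> (\<Union>i. C i)" "\<And>i. bounded (C i)"
      "(\<Sum>i. ennreal (diameter (C i) powr s)) \<le> ennreal ?\<gamma>"
      using assms(2)[OF pos] unfolding covered_def by blast
    have "diameter (C i) \<le> \<delta>" for i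
    proof -
      have "(\<Sum>j\<in>{i}. ennreal (diameter (C j) powr s)) \<le> (\<Sum>i. ennreal (diameter (C i) powr s))"
        by (rule sum_le_suminf) auto
      with C(3) have "ennreal (diameter (C i) powr s) \<le> ennreal ?\<gamma>" by simp
      then have "diameter (C i) powr s \<le> ?\<gamma>" using pos by (subst (asm) ennreal_le_iff) auto
      then have "diameter (C i) powr s \<le> \<delta> powr s" by simp
      then show ?thesis using powr_less_mono2[OF assms(1), of \<delta> "diameter (C i)"] that(1) by fastforce
    qed
    then have "hausdorff_content \<delta> s D \<le> (\<Sum>i. ennreal (diameter (C i) powr s))"
      unfolding hausdorff_content_def using C by (intro INF_lower) auto
    also have "\<dots> \<le> ennreal ?\<gamma>" by (rule C(3))
    also have "\<dots> \<le> ennreal \<gamma>" by (intro ennreal_leI) simp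
    finally show ?thesis by simp
  qed
  have "hausdorff_content \<delta> s D \<le> 0" if "0 < \<delta>" for \<delta>
    by (rule ennreal_le_epsilon) (rule *[OF that])
  then show ?thesis unfolding hausdorff_measure_def
    by (intro antisym SUP_least) auto
qed

lemma hausdorff_dim_le:
  assumes "0 < s" "hausdorff_measure s D = 0"
  shows "hausdorff_dim D \<le> ennreal s"
  unfolding hausdorff_dim_def using assms by (intro INF_lower) auto

text \<open>Borel-Cantelli: the limsup set lies in every tail union, and the tail sums of
  \<open>a\<close> tend to 0.\<close>

lemma covered_limsup:
  fixes Z :: "nat \<Rightarrow> 'a::metric_space set"
  assumes Z: "\<And>r. r0 \<le> r \<Longrightarrow> covered s (Z r) (ennreal (a r))" and a: "summable a" "\<And>r. 0 \<le> a r"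
    and \<gamma>: "0 < \<gamma>"
  shows "covered s {e. \<exists>\<^sub>F r in sequentially. e \<in> Z r} (ennreal \<gamma>)"
proof -
  have "(\<lambda>n. \<Sum>k. a (k + n)) \<longlonglongrightarrow> 0"
    using suminf_exist_split2[OF a(1)] .
  then have "\<forall>\<^sub>F n in sequentially. (\<Sum>k. a (k + n)) < \<gamma>" using \<gamma> by (rule order_tendstoD)
  then obtain n where n: "(\<Sum>k. a (k + n)) < \<gamma>" "r0 \<le> n"
    unfolding eventually_sequentially using nat_le_linear by blast
  have "covered s (\<Union>k. Z (k + n)) (\<Sum>k. ennreal (a (k + n)))"
    using Z n(2) by (intro covered_UN) auto
  moreover have "(\<Sum>k. ennreal (a (k + n))) = ennreal (\<Sum>k. a (k + n))"
    using a by (intro suminf_ennreal2 summable_ignore_initial_segment) auto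
  moreover have "{e. \<exists>\<^sub>F r in sequentially. e \<in> Z r} \<subseteq> (\<Union>k. Z (k + n))"
  proof
    fix e assume "e \<in> {e. \<exists>\<^sub>F r in sequentially. e \<in> Z r}"
    then obtain r where "r \<ge> n" "e \<in> Z r" unfolding frequently_sequentially by blast
    then have "e \<in> Z ((r - n) + n)" by simp
    then show "e \<in> (\<Union>k. Z (k + n))" by blast
  qed
  moreover have "ennreal (\<Sum>k. a (k + n)) \<le> ennreal \<gamma>" using n(1) by (intro ennreal_leI) simp
  ultimately show ?thesis
    using covered_mono[of s "\<Union>k. Z (k + n)" "\<Sum>k. ennreal (a (k + n))"] by simp
qed

section \<open>Covers by dyadic intervals\<close>

text \<open>The covering sets are sorted by scale: weight about \<open>2 powr (- \<tau> * r)\<close>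
  means scale \<open>r\<close>. Total weight at most 1 leaves room for at most
  \<open>2 powr (\<tau> * (r + 1))\<close> sets per scale, and total weight at most
  \<open>\<gamma>\<close> excludes scales below \<open>m\<close>.\<close>

lemma cover_by_dyadic_intervals_at:
  fixes Y :: "real set"
  assumes \<tau>: "0 < \<tau>" and Y: "hausdorff_measure \<tau> Y = 0"
  shows "\<exists>T. (\<forall>r. finite (T r) \<and> real (card (T r)) \<le> 2 powr (\<tau> * (real r + 1))) \<and>
    (\<forall>y\<in>Y. \<exists>r\<ge>m. \<exists>c\<in>T r. \<bar>y - c\<bar> \<le> 1 / 2 ^ r)"
proof -
  define \<gamma> where "\<gamma> = 2 powr (- real m * \<tau>)"
  have \<gamma>: "0 < \<gamma>" "\<gamma> \<le> 1" using \<tau> powr_mono[of "- real m * \<tau>" 0 2] by (simp_all add: \<gamma>_def)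
  have "hausdorff_content 1 \<tau> Y \<le> hausdorff_measure \<tau> Y"
    unfolding hausdorff_measure_def by (intro SUP_upper) auto
  then have "hausdorff_content 1 \<tau> Y < ennreal (\<gamma> / 2)" using Y \<gamma> by simp
  then obtain C where C: "Y \<subseteq> (\<Union>i. C i)" "\<And>i. bounded (C i)"
    "(\<Sum>i. ennreal (diameter (C i) powr \<tau>)) < ennreal (\<gamma> / 2)"
    unfolding hausdorff_content_def INF_less_iff by blast
  \<comment> \<open>The second summand keeps the weight positive when the diameter is 0, so that
    such a set has a scale too; these summands add at most \<open>\<gamma> / 2\<close>.\<close>
  define a where "a = (\<lambda>i. diameter (C i) powr \<tau> + (\<gamma> / 2) * (1 / 2) ^ Suc i)"
  have a_pos: "0 < a i" for i using \<gamma> by (auto simp: a_def intro!: add_nonneg_pos)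
  have sum_a: "(\<Sum>i\<in>F. a i) \<le> \<gamma>" if "finite F" for F
  proof -
    have "ennreal (\<Sum>i\<in>F. diameter (C i) powr \<tau>) = (\<Sum>i\<in>F. ennreal (diameter (C i) powr \<tau>))"
      by (simp add: sum_ennreal)
    also have "\<dots> \<le> (\<Sum>i. ennreal (diameter (C i) powr \<tau>))"
      using that by (intro sum_le_suminf) auto
    also have "\<dots> \<le> ennreal (\<gamma> / 2)" using C(3) by simp
    finally have 1: "(\<Sum>i\<in>F. diameter (C i) powr \<tau>) \<le> \<gamma> / 2"
      using \<gamma> by (subst (asm) ennreal_le_iff) auto
    have "(\<Sum>i\<in>F. (1 / 2 :: real) ^ Suc i) \<le> (\<Sum>i. (1 / 2) ^ Suc i)"
      using that power_half_series by (intro sum_le_suminf) (auto simp: sums_iff)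
    also have "\<dots> = 1" using power_half_series by (simp add: sums_iff)
    finally have "(\<gamma> / 2) * (\<Sum>i\<in>F. (1 / 2 :: real) ^ Suc i) \<le> (\<gamma> / 2) * 1"
      using \<gamma> by (intro mult_left_mono) auto
    then show ?thesis using 1 unfolding a_def sum.distrib sum_distrib_left by linarith
  qed
  define \<rho> where "\<rho> = (\<lambda>i. nat \<lfloor>- log 2 (a i) / \<tau>\<rfloor>)"
  have a_le: "a i \<le> \<gamma>" for i using sum_a[of "{i}"] by simp
  have log_ge: "real m \<le> - log 2 (a i) / \<tau>" for i
  proof -
    have "log 2 (a i) \<le> log 2 \<gamma>" using a_le a_pos \<gamma> by simp
    also have "\<dots> = - real m * \<tau>" by (simp add: \<gamma>_def)
    finally show ?thesis using \<tau> by (simp add: field_simps)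
  qed
  have \<rho>: "real (\<rho> i) \<le> - log 2 (a i) / \<tau>" "- log 2 (a i) / \<tau> < real (\<rho> i) + 1" "m \<le> \<rho> i" for i
  proof -
    have nn: "0 \<le> - log 2 (a i) / \<tau>" using log_ge[of i] by linarith
    show "real (\<rho> i) \<le> - log 2 (a i) / \<tau>" "- log 2 (a i) / \<tau> < real (\<rho> i) + 1"
      unfolding \<rho>_def using nn by linarith+
    show "m \<le> \<rho> i" unfolding \<rho>_def using log_ge[of i] by linarith
  qed
  have a_lower: "2 powr (- \<tau> * (real (\<rho> i) + 1)) \<le> a i" for i
  proof -
    have "- \<tau> * (real (\<rho> i) + 1) \<le> log 2 (a i)" using \<rho>(2)[of i] \<tau> by (simp add: field_simps)
    then have "2 powr (- \<tau> * (real (\<rho> i) + 1)) \<le> 2 powr log 2 (a i)" by (intro powr_mono) auto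
    then show ?thesis using a_pos by simp
  qed
  have diam: "diameter (C i) \<le> 1 / 2 ^ \<rho> i" for i
  proof (rule ccontr)
    assume "\<not> ?thesis"
    then have "(1 / 2 ^ \<rho> i) powr \<tau> \<le> diameter (C i) powr \<tau>" using \<tau> by (intro powr_mono2) auto
    also have "\<dots> < a i" using \<gamma> by (simp add: a_def)
    also have "\<dots> = 2 powr log 2 (a i)" using a_pos by simp
    also have "\<dots> \<le> 2 powr (- (real (\<rho> i) * \<tau>))"
      using \<rho>(1)[of i] \<tau> by (intro powr_mono) (auto simp: field_simps)
    also have "\<dots> = (1 / 2 ^ \<rho> i) powr \<tau>"
      by (simp add: powr_minus_divide powr_divide flip: powr_powr powr_realpow)
    finally show False by simp
  qed
  have card: "finite I \<and> real (card I) \<le> 2 powr (\<tau> * (real r + 1))" if I: "I \<subseteq> {i. \<rho> i = r}" for r I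
  proof -
    have *: "real (card F) \<le> 2 powr (\<tau> * (real r + 1))" if F: "F \<subseteq> I" "finite F" for F
    proof -
      have "real (card F) * 2 powr (- \<tau> * (real r + 1)) = (\<Sum>i\<in>F. 2 powr (- \<tau> * (real r + 1)))" by simp
      also have "\<dots> \<le> (\<Sum>i\<in>F. a i)" using a_lower F I by (intro sum_mono) auto
      also have "\<dots> \<le> 1" using sum_a[OF F(2)] \<gamma> by simp
      finally show ?thesis
        unfolding mult_minus_left powr_minus_divide by (simp add: divide_le_eq)
    qed
    have "finite I"
    proof (rule finite_if_finite_subsets_card_bdd[of _ "nat \<lceil>2 powr (\<tau> * (real r + 1))\<rceil>", THEN conjunct1])
      fix F assume "F \<subseteq> I" "finite F"
      then have "real (card F) \<le> 2 powr (\<tau> * (real r + 1))" by (rule *)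
      then show "card F \<le> nat \<lceil>2 powr (\<tau> * (real r + 1))\<rceil>" by linarith
    qed
    then show ?thesis using * by blast
  qed
  \<comment> \<open>For an empty \<open>C i\<close> this is an arbitrary point. It is counted like
    the others and does no harm.\<close>
  define c where "c = (\<lambda>i. SOME z. z \<in> C i)"
  define T where "T = (\<lambda>r. c ` {i. \<rho> i = r})"
  have "finite (T r) \<and> real (card (T r)) \<le> 2 powr (\<tau> * (real r + 1))" for r
  proof -
    have fin: "finite {i. \<rho> i = r}" and le: "real (card {i. \<rho> i = r}) \<le> 2 powr (\<tau> * (real r + 1))"
      using card[of "{i. \<rho> i = r}" r] by simp_all
    have "real (card (T r)) \<le> real (card {i. \<rho> i = r})"
      unfolding T_def using card_image_le[OF fin] by (rule of_nat_mono)
    then show ?thesis using le fin by (simp add: T_def)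
  qed
  moreover have "\<exists>r\<ge>m. \<exists>z\<in>T r. \<bar>y - z\<bar> \<le> 1 / 2 ^ r" if y: "y \<in> Y" for y
  proof -
    obtain i where i: "y \<in> C i" using C(1) y by blast
    then have "c i \<in> C i" unfolding c_def by (rule someI)
    then have "dist y (c i) \<le> 1 / 2 ^ \<rho> i"
      using diameter_bounded_bound[OF C(2) i] diam[of i] by fastforce
    then show ?thesis using \<rho>(3)[of i] by (intro exI[of _ "\<rho> i"]) (auto simp: T_def dist_real_def)
  qed
  ultimately show ?thesis by blast
qed

text \<open>The families for all \<open>m \<le> r\<close> are merged at scale \<open>r\<close>. A
  point has a centre at some scale beyond every \<open>m\<close>, hence at infinitely many, and the
  factor \<open>r + 1\<close> fits into the gap between \<open>\<tau>\<close> and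
  \<open>t\<close>.\<close>

lemma cover_by_dyadic_intervals:
  fixes Y :: "real set"
  assumes "hausdorff_dim Y < ennreal t"
  shows "\<exists>T. (\<forall>r. finite (T r) \<and> real (card (T r)) \<le> 2 powr (t * real r)) \<and>
    (\<forall>y\<in>Y. \<exists>\<^sub>F r in sequentially. \<exists>c\<in>T r. \<bar>y - c\<bar> \<le> 1 / 2 ^ r)"
proof -
  obtain \<tau> where \<tau>: "0 < \<tau>" "hausdorff_measure \<tau> Y = 0" "ennreal \<tau> < ennreal t"
    using assms unfolding hausdorff_dim_def INF_less_iff by blast
  have "\<tau> < t" using \<tau>(1,3) by (simp add: ennreal_less_iff)
  obtain T where T: "\<And>m r. finite (T m r)" "\<And>m r. real (card (T m r)) \<le> 2 powr (\<tau> * (real r + 1))"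
    "\<And>m y. y \<in> Y \<Longrightarrow> \<exists>r\<ge>m. \<exists>c\<in>T m r. \<bar>y - c\<bar> \<le> 1 / 2 ^ r"
    using cover_by_dyadic_intervals_at[OF \<tau>(1,2)] by metis
  have "\<forall>\<^sub>F r in sequentially. (real r + 1) * 2 powr (\<tau> * (real r + 1)) \<le> 2 powr (t * real r)"
    using \<open>\<tau> < t\<close> \<tau>(1) by real_asymp
  then obtain r0 where r0: "\<And>r. r \<ge> r0 \<Longrightarrow> (real r + 1) * 2 powr (\<tau> * (real r + 1)) \<le> 2 powr (t * real r)"
    unfolding eventually_sequentially by blast
  define S where "S = (\<lambda>r. if r < r0 then {} else \<Union>m\<le>r. T m r)"
  have "real (card (S r)) \<le> 2 powr (t * real r)" for r
  proof (cases "r < r0")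
    case False
    then have "real (card (S r)) \<le> (\<Sum>m\<le>r. real (card (T m r)))"
      unfolding S_def using card_UN_le[of "{..r}" "\<lambda>m. T m r"] by (simp flip: of_nat_sum)
    also have "\<dots> \<le> (\<Sum>m\<le>r. 2 powr (\<tau> * (real r + 1)))" using T(2) by (intro sum_mono)
    also have "\<dots> \<le> 2 powr (t * real r)" using r0[of r] False by (simp add: add.commute)
    finally show ?thesis .
  qed (simp add: S_def)
  moreover have "\<exists>\<^sub>F r in sequentially. \<exists>c\<in>S r. \<bar>y - c\<bar> \<le> 1 / 2 ^ r" if y: "y \<in> Y" for y
    unfolding frequently_sequentially
  proof
    fix N
    obtain r c where "r \<ge> max N r0" "c \<in> T (max N r0) r" "\<bar>y - c\<bar> \<le> 1 / 2 ^ r"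
      using T(3)[OF y, of "max N r0"] by blast
    then show "\<exists>r\<ge>N. \<exists>c\<in>S r. \<bar>y - c\<bar> \<le> 1 / 2 ^ r"
      unfolding S_def by (intro exI[of _ r]) auto
  qed
  moreover have "finite (S r)" for r unfolding S_def using T(1) by auto
  ultimately show ?thesis by blast
qed

section \<open>Separated sets and nets\<close>

text \<open>A separated subset of largest cardinality cannot be enlarged, so its balls cover
  \<open>Z\<close>; the bound \<open>N\<close> makes sure that a largest one exists.\<close>

lemma separated_cover:
  fixes Z :: "'a::metric_space set"
  assumes "0 \<le> \<delta>" and bound: "\<And>Y. finite Y \<Longrightarrow> Y \<subseteq> Z \<Longrightarrow> pairwise (\<lambda>x y. \<delta> < dist x y) Y \<Longrightarrow> real (card Y) \<le> N"
  shows "\<exists>Y. finite Y \<and> Y \<subseteq> Z \<and> pairwise (\<lambda>x y. \<delta> < dist x y) Y \<and> Z \<subseteq> (\<Union>y\<in>Y. cball y \<delta>)"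
proof -
  define Q where "Q = (\<lambda>Y. finite Y \<and> Y \<subseteq> Z \<and> pairwise (\<lambda>x y. \<delta> < dist x y) Y)"
  have 1: "Q {}" by (simp add: Q_def)
  have 2: "\<forall>Y. Q Y \<longrightarrow> card Y < Suc (nat \<lfloor>N\<rfloor>)"
    using bound unfolding Q_def by (simp add: le_nat_floor less_Suc_eq_le)
  obtain Y where Y: "Q Y" "\<And>Y'. Q Y' \<Longrightarrow> card Y' \<le> card Y"
    using ex_has_greatest_nat[OF 1 2] by (elim exE conjE) simp
  have "Z \<subseteq> (\<Union>y\<in>Y. cball y \<delta>)"
  proof (rule ccontr)
    assume "\<not> ?thesis"
    then obtain z where z: "z \<in> Z" "\<And>y. y \<in> Y \<Longrightarrow> \<delta> < dist y z" by fastforce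
    then have "z \<notin> Y" using \<open>0 \<le> \<delta>\<close> by fastforce
    moreover have "Q (insert z Y)"
      using Y(1) z unfolding Q_def by (auto simp: pairwise_insert dist_commute)
    ultimately show False using Y(2)[of "insert z Y"] Y(1) unfolding Q_def by simp
  qed
  then show ?thesis using Y(1) unfolding Q_def by blast
qed

text \<open>Take a maximal \<open>2 * \<rho>\<close>-separated set of points with crowded balls.
  These balls are disjoint, so few of them fit into \<open>P\<close>, and by maximality every
  crowded point is near a centre.\<close>

lemma dense_points_net:
  fixes P :: "'a::metric_space set"
  assumes "finite P" "0 < N" "0 \<le> \<rho>"
  shows "\<exists>Y \<subseteq> P. real (card Y) * N \<le> real (card P) \<and>
    (\<forall>p\<in>P. N < real (card (P \<inter> cball p \<rho>)) \<longrightarrow> (\<exists>y\<in>Y. dist y p \<le> 2 * \<rho>))"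
proof -
  let ?X = "{p \<in> P. N < real (card (P \<inter> cball p \<rho>))}"
  have count: "real (card Y) * N \<le> real (card P)"
    if Y: "finite Y" "Y \<subseteq> ?X" "pairwise (\<lambda>x y. 2 * \<rho> < dist x y) Y" for Y
  proof -
    have disj: "(P \<inter> cball x \<rho>) \<inter> (P \<inter> cball y \<rho>) = {}" if "x \<in> Y" "y \<in> Y" "x \<noteq> y" for x y
    proof -
      have "2 * \<rho> < dist x y" using Y(3) that by (auto simp: pairwise_def)
      then have "\<not> (dist x z \<le> \<rho> \<and> dist y z \<le> \<rho>)" for z
        using dist_triangle2[of x y z] by auto
      then show ?thesis by auto
    qed
    have "real (card Y) * N = (\<Sum>y\<in>Y. N)" by simp
    also have "\<dots> \<le> (\<Sum>y\<in>Y. real (card (P \<inter> cball y \<rho>)))" using Y(2) by (intro sum_mono) auto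
    also have "\<dots> = real (card (\<Union>y\<in>Y. P \<inter> cball y \<rho>))"
      using Y(1) assms(1) disj by (subst card_UN_disjoint) auto
    also have "\<dots> \<le> real (card P)" using assms(1) by (intro of_nat_mono card_mono) auto
    finally show ?thesis .
  qed
  have "\<exists>Y. finite Y \<and> Y \<subseteq> ?X \<and> pairwise (\<lambda>x y. 2 * \<rho> < dist x y) Y \<and> ?X \<subseteq> (\<Union>y\<in>Y. cball y (2 * \<rho>))"
    using assms count by (intro separated_cover[where N = "real (card P) / N"]) (simp_all add: field_simps)
  then obtain Y where Y: "finite Y" "Y \<subseteq> ?X" "pairwise (\<lambda>x y. 2 * \<rho> < dist x y) Y"
    "?X \<subseteq> (\<Union>y\<in>Y. cball y (2 * \<rho>))" by blast
  have "\<exists>y\<in>Y. dist y p \<le> 2 * \<rho>" if "p \<in> P" "N < real (card (P \<inter> cball p \<rho>))" for p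
  proof -
    have "p \<in> (\<Union>y\<in>Y. cball y (2 * \<rho>))" using that by (intro subsetD[OF Y(4)]) simp
    then show ?thesis by auto
  qed
  then show ?thesis using Y(2) count[OF Y(1-3)] by (intro exI[of _ Y]) auto
qed


section \<open>Directions almost orthogonal to many vectors\<close>

text \<open>Here \<open>w\<close> is the unit vector \<open>u\<close> along \<open>v\<close>, turned
  by a right angle. If \<open>0 \<le> e \<bullet> w\<close>, the squared distance
  \<open>2 - 2 * (e \<bullet> w)\<close> is at most \<open>2 * (e \<bullet> u)\<^sup>2\<close>;
  otherwise \<open>- w\<close> takes the place of \<open>w\<close>.\<close>

lemma almost_orthogonal_near_normal:
  fixes v :: "real ^ 2"
  assumes "v \<noteq> 0"
  shows "\<exists>w. \<forall>e a. norm e = 1 \<longrightarrow> \<bar>e \<bullet> v\<bar> \<le> a * norm v \<longrightarrow> dist e w \<le> 2 * a \<or> dist e (- w) \<le> 2 * a"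
proof -
  define u where "u = v /\<^sub>R norm v"
  have u: "norm u = 1" using assms by (simp add: u_def)
  define w :: "real ^ 2" where "w = vector [- u $ 2, u $ 1]"
  have near: "dist e w \<le> 2 * a"
    if e: "norm e = 1" and w: "norm w = 1" and nn: "0 \<le> e \<bullet> w" and a: "0 \<le> a"
      and pyth: "(e \<bullet> u)\<^sup>2 + (e \<bullet> w)\<^sup>2 = 1" and au: "\<bar>e \<bullet> u\<bar> \<le> a" for e w :: "real ^ 2" and a
  proof -
    have "e \<bullet> w \<le> 1" using norm_cauchy_schwarz[of e w] e w by simp
    then have "(e \<bullet> w)\<^sup>2 \<le> e \<bullet> w" using nn by (simp add: power2_eq_square mult_left_le_one_le)
    have "(dist e w)\<^sup>2 = 2 - 2 * (e \<bullet> w)"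
      using e w unfolding dist_norm power2_norm_eq_inner
      by (simp add: inner_diff_left inner_diff_right inner_commute norm_eq_1)
    also have "\<dots> \<le> 2 * (e \<bullet> u)\<^sup>2" using pyth \<open>(e \<bullet> w)\<^sup>2 \<le> e \<bullet> w\<close> by linarith
    also have "\<dots> \<le> 2 * a\<^sup>2" using au power_mono[OF au, of 2] by simp
    also have "\<dots> \<le> (2 * a)\<^sup>2" by (simp add: power_mult_distrib)
    finally show ?thesis by (rule power2_le_imp_le) (use a in simp)
  qed
  have "dist e w \<le> 2 * a \<or> dist e (- w) \<le> 2 * a" if "norm e = 1" "\<bar>e \<bullet> v\<bar> \<le> a * norm v" for e a
  proof -
    have eu: "\<bar>e \<bullet> u\<bar> \<le> a" using that(2) assms by (simp add: u_def abs_mult divide_simps)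
    then have a: "0 \<le> a" by linarith
    have "u $ 1 * u $ 1 + u $ 2 * u $ 2 = 1" "e $ 1 * e $ 1 + e $ 2 * e $ 2 = 1"
      using u that(1) by (simp_all add: norm_eq_1 inner_vec_def sum_2)
    then have "norm w = 1" "(e \<bullet> u)\<^sup>2 + (e \<bullet> w)\<^sup>2 = 1"
      by (auto simp: norm_eq_1 inner_vec_def sum_2 w_def) algebra
    then show ?thesis
      using near[of e w a] near[of e "- w" a] that(1) a eu by (cases "0 \<le> e \<bullet> w") auto
  qed
  then show ?thesis by blast
qed

text \<open>Double counting on a maximal \<open>4 * a\<close>-separated subset \<open>Y\<close> of
  \<open>Z\<close>: each vector is almost orthogonal to at most two elements of \<open>Y\<close>,
  one near each of its unit normals, and each element of \<open>Y\<close> is almost orthogonal to at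
  least \<open>t\<close> vectors. Balls of radius \<open>4 * a\<close> around \<open>Y\<close> cover
  \<open>Z\<close>.\<close>

lemma covered_almost_orthogonal:
  fixes Z :: "(real ^ 2) set" and v :: "'i \<Rightarrow> real ^ 2"
  assumes I: "finite I" "\<And>i. i \<in> I \<Longrightarrow> v i \<noteq> 0" and a: "0 \<le> a" and t: "0 < t" and s: "0 < s"
    and Z: "\<And>e. e \<in> Z \<Longrightarrow> norm e = 1"
      "\<And>e. e \<in> Z \<Longrightarrow> t \<le> real (card {i \<in> I. \<bar>e \<bullet> v i\<bar> \<le> a * norm (v i)})"
  shows "covered s Z (ennreal (2 * real (card I) / t * (8 * a) powr s))"
proof -
  let ?R = "\<lambda>e i. \<bar>e \<bullet> v i\<bar> \<le> a * norm (v i)"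
  have count: "real (card Y) \<le> 2 * real (card I) / t"
    if Y: "finite Y" "Y \<subseteq> Z" "pairwise (\<lambda>x y. 4 * a < dist x y) Y" for Y
  proof -
    have two: "real (card {e \<in> Y. ?R e i}) \<le> 2" if i: "i \<in> I" for i
    proof -
      obtain w where w: "\<And>e. norm e = 1 \<Longrightarrow> ?R e i \<Longrightarrow> dist e w \<le> 2 * a \<or> dist e (- w) \<le> 2 * a"
        using almost_orthogonal_near_normal[OF I(2)[OF i]] by blast
      have one: "card {e \<in> Y. dist e z \<le> 2 * a} \<le> 1" for z
      proof -
        have "x = y" if "x \<in> Y" "y \<in> Y" "dist x z \<le> 2 * a" "dist y z \<le> 2 * a" for x y
        proof (rule ccontr)
          assume "x \<noteq> y"
          then have "4 * a < dist x y" using Y(3) that by (auto simp: pairwise_def)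
          then show False using dist_triangle2[of x y z] that by linarith
        qed
        then show ?thesis using Y(1) by (auto simp: card_le_Suc0_iff_eq)
      qed
      have "{e \<in> Y. ?R e i} \<subseteq> {e \<in> Y. dist e w \<le> 2 * a} \<union> {e \<in> Y. dist e (- w) \<le> 2 * a}"
        using w Y(2) Z(1) by blast
      then have "card {e \<in> Y. ?R e i} \<le> card ({e \<in> Y. dist e w \<le> 2 * a} \<union> {e \<in> Y. dist e (- w) \<le> 2 * a})"
        using Y(1) by (intro card_mono) auto
      also have "\<dots> \<le> card {e \<in> Y. dist e w \<le> 2 * a} + card {e \<in> Y. dist e (- w) \<le> 2 * a}"
        by (rule card_Un_le)
      also have "\<dots> \<le> 2" using one[of w] one[of "- w"] by linarith
      finally show ?thesis by simp
    qed
    have card_sum: "real (card {x \<in> A. Q x}) = (\<Sum>x\<in>A. if Q x then 1 else 0)" if "finite A" for A :: "'b set" and Q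
      using that by (simp add: sum.If_cases Int_def conj_commute)
    have card_sum': "real (card {x \<in> A. Q x}) = (\<Sum>x\<in>A. if Q x then 1 else 0)" if "finite A" for A :: "'i set" and Q
      using that by (simp add: sum.If_cases Int_def conj_commute)
    have "real (card Y) * t = (\<Sum>e\<in>Y. t)" by simp
    also have "\<dots> \<le> (\<Sum>e\<in>Y. real (card {i \<in> I. ?R e i}))" using Z(2) Y(2) by (intro sum_mono) auto
    also have "\<dots> = (\<Sum>e\<in>Y. \<Sum>i\<in>I. if ?R e i then 1 else 0)"
      using card_sum'[OF I(1)] by simp
    also have "\<dots> = (\<Sum>i\<in>I. \<Sum>e\<in>Y. if ?R e i then 1 else 0)" by (rule sum.swap)
    also have "\<dots> = (\<Sum>i\<in>I. real (card {e \<in> Y. ?R e i}))"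
      using Y(1) by (simp add: sum.If_cases Int_def conj_commute)
    also have "\<dots> \<le> (\<Sum>i\<in>I. 2)" using two by (intro sum_mono) auto
    finally show ?thesis using t by (simp add: field_simps)
  qed
  have "\<exists>Y. finite Y \<and> Y \<subseteq> Z \<and> pairwise (\<lambda>x y. 4 * a < dist x y) Y \<and> Z \<subseteq> (\<Union>y\<in>Y. cball y (4 * a))"
    using a count by (intro separated_cover[where N = "2 * real (card I) / t"]) simp_all
  then obtain Y where Y: "finite Y" "Y \<subseteq> Z" "pairwise (\<lambda>x y. 4 * a < dist x y) Y"
    "Z \<subseteq> (\<Union>y\<in>Y. cball y (4 * a))" by blast
  have "covered s (\<Union>y\<in>Y. cball y (4 * a)) (\<Sum>y\<in>Y. ennreal (diameter (cball y (4 * a)) powr s))"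
    using Y(1) by (intro covered_finite_UN covered_bounded) auto
  moreover have "(\<Sum>y\<in>Y. ennreal (diameter (cball y (4 * a)) powr s)) \<le> ennreal (2 * real (card I) / t * (8 * a) powr s)"
  proof -
    have "(\<Sum>y\<in>Y. ennreal (diameter (cball y (4 * a)) powr s)) = ennreal (real (card Y) * (8 * a) powr s)"
      using a by (simp add: ennreal_mult ennreal_of_nat_eq_real_of_nat)
    also have "\<dots> \<le> ennreal (2 * real (card I) / t * (8 * a) powr s)"
      using count[OF Y(1-3)] by (intro ennreal_leI mult_right_mono) auto
    finally show ?thesis .
  qed
  ultimately show ?thesis using covered_mono[OF _ Y(4)] by blast
qed


section \<open>The energy estimate\<close>

text \<open>The count of ordered pairs, diagonal included, is a discrete energy of the projection at
  scale \<open>1 / 2 ^ r\<close>. Two points within \<open>2 / 2 ^ r\<close> of the same centre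
  differ by at most \<open>4 / 2 ^ r\<close>.\<close>

definition energy_exceptions :: "(real ^ 2) set \<Rightarrow> nat \<Rightarrow> real \<Rightarrow> (real ^ 2) set" where
  "energy_exceptions G r t = {e \<in> sphere 0 1.
     t \<le> real (card {q \<in> G \<times> G. \<bar>e \<bullet> (fst q - snd q)\<bar> \<le> 4 / 2 ^ r})}"

text \<open>Pairs are sorted dyadically by distance. An exceptional direction sees at least
  \<open>t / (4 * r)\<close> pairs in one of the classes \<open>Q j\<close>, to which
  \<open>covered_almost_orthogonal\<close> applies. The decay \<open>2 powr (- s * j)\<close> of the
  class sizes cancels the growth \<open>2 powr (s * j)\<close> of the arcs.\<close>

lemma covered_energy_exceptions:
  fixes G :: "(real ^ 2) set" and k r :: nat and s \<epsilon> :: real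
  defines "j0 \<equiv> nat \<lfloor>\<epsilon> * real r / s\<rfloor>"
  assumes pos: "0 < \<epsilon>" "\<epsilon> < s" and r: "1 \<le> r" "4 \<le> 2 powr (\<epsilon> * real r)"
    and G: "finite G" "card G \<le> 2 ^ (k + 1)"
    and spread: "\<And>j p. j0 \<le> j \<Longrightarrow> j \<le> r \<Longrightarrow> p \<in> G \<Longrightarrow>
      real (card (G \<inter> cball p (1 / 2 ^ j))) \<le> 2 powr (real k - (s - \<epsilon>) * real j)"
  shows "covered s (energy_exceptions G r (2 powr (2 * real k - (s - 2 * \<epsilon>) * real r)))
    (ennreal (32 * 64 powr s * (real r)\<^sup>2 * 2 powr (- \<epsilon> * real r)))"
proof -
  define t where "t = 2 powr (2 * real k - (s - 2 * \<epsilon>) * real r)"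
  have t: "0 < t" by (simp add: t_def)
  \<comment> \<open>The class \<open>j0\<close> also takes all pairs that are further apart.\<close>
  define Q where "Q = (\<lambda>j. {q \<in> G \<times> G. (j = j0 \<or> dist (fst q) (snd q) \<le> 1 / 2 ^ j) \<and>
    1 / 2 ^ Suc j < dist (fst q) (snd q)})"
  define near where "near = {q \<in> G \<times> G. dist (fst q) (snd q) \<le> 1 / 2 ^ r}"
  let ?R = "\<lambda>e q. \<bar>e \<bullet> (fst q - snd q)\<bar> \<le> 4 / 2 ^ r"
  have cardG: "real (card G) \<le> 2 powr (real k + 1)"
  proof -
    have "real (card G) \<le> real (2 ^ (k + 1))" using G(2) by (intro of_nat_mono)
    also have "\<dots> = 2 powr (real k + 1)" by (simp add: powr_add powr_realpow)
    finally show ?thesis .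
  qed
  have s: "0 < s" using pos by simp
  have j0: "s * real j0 \<le> \<epsilon> * real r" "j0 < r"
  proof -
    have "real j0 \<le> \<epsilon> * real r / s" using pos s unfolding j0_def by (simp add: of_nat_floor)
    then show "s * real j0 \<le> \<epsilon> * real r" using s by (simp add: field_simps)
    also have "\<dots> < s * real r" using pos r by simp
    finally show "j0 < r" using s by simp
  qed
  have pairs: "real (card {q \<in> G \<times> G. dist (fst q) (snd q) \<le> 1 / 2 ^ j}) \<le> 2 powr (2 * real k + 1 - (s - \<epsilon>) * real j)"
    if "j0 \<le> j" "j \<le> r" for j
  proof -
    have "{q \<in> G \<times> G. dist (fst q) (snd q) \<le> 1 / 2 ^ j} = (SIGMA p:G. G \<inter> cball p (1 / 2 ^ j))" by auto
    then have "real (card {q \<in> G \<times> G. dist (fst q) (snd q) \<le> 1 / 2 ^ j}) = (\<Sum>p\<in>G. real (card (G \<inter> cball p (1 / 2 ^ j))))"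
      using G(1) by simp
    also have "\<dots> \<le> (\<Sum>p\<in>G. 2 powr (real k - (s - \<epsilon>) * real j))"
      using spread that by (intro sum_mono) auto
    also have "\<dots> = real (card G) * 2 powr (real k - (s - \<epsilon>) * real j)" by simp
    also have "\<dots> \<le> 2 powr (real k + 1) * 2 powr (real k - (s - \<epsilon>) * real j)"
      using cardG by (intro mult_right_mono) auto
    also have "\<dots> = 2 powr (2 * real k + 1 - (s - \<epsilon>) * real j)"
      unfolding powr_add[symmetric] by (rule arg_cong[where f = "\<lambda>x. 2 powr x"]) simp
    finally show ?thesis .
  qed
  \<comment> \<open>For \<open>j = j0\<close> all pairs are counted, and
    \<open>s * j0 \<le> \<epsilon> * r\<close> pays for this; for larger \<open>j\<close> the
    spreading hypothesis gives the bound.\<close>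
  have cardQ: "real (card (Q j)) \<le> 2 powr (2 * real k + 2 - s * real j + \<epsilon> * real r)" if "j0 \<le> j" "j < r" for j
  proof (cases "j = j0")
    case True
    have "real (card (Q j)) \<le> real (card (G \<times> G))"
      using G(1) unfolding Q_def by (intro of_nat_mono card_mono) auto
    also have "\<dots> = real (card G) * real (card G)" by (simp add: card_cartesian_product)
    also have "\<dots> \<le> 2 powr (real k + 1) * 2 powr (real k + 1)" using cardG by (intro mult_mono) auto
    also have "\<dots> = 2 powr (2 * real k + 2)" by (simp flip: powr_add)
    also have "\<dots> \<le> 2 powr (2 * real k + 2 - s * real j + \<epsilon> * real r)"
      using j0(1) True by (intro powr_mono) auto
    finally show ?thesis .
  next
    case False
    have "real (card (Q j)) \<le> real (card {q \<in> G \<times> G. dist (fst q) (snd q) \<le> 1 / 2 ^ j})"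
      using G(1) False unfolding Q_def by (intro of_nat_mono card_mono) auto
    also have "\<dots> \<le> 2 powr (2 * real k + 1 - (s - \<epsilon>) * real j)" using pairs that by simp
    also have "\<dots> \<le> 2 powr (2 * real k + 2 - s * real j + \<epsilon> * real r)"
    proof (intro powr_mono)
      have "\<epsilon> * real j \<le> \<epsilon> * real r" using pos that by simp
      then show "2 * real k + 1 - (s - \<epsilon>) * real j \<le> 2 * real k + 2 - s * real j + \<epsilon> * real r"
        by (simp add: algebra_simps)
    qed simp
    finally show ?thesis .
  qed
  have card_near: "real (card near) \<le> t / 2"
  proof -
    have "2 powr (2 * real k + 1 - (s - \<epsilon>) * real r) * 2 powr (\<epsilon> * real r) = 2 powr 1 * t"
      unfolding t_def powr_add[symmetric] by (rule arg_cong[where f = "\<lambda>x. 2 powr x"]) (simp add: algebra_simps)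
    then have eq: "2 powr (2 * real k + 1 - (s - \<epsilon>) * real r) = 2 * t / 2 powr (\<epsilon> * real r)"
      by (simp add: eq_divide_eq)
    have "real (card near) \<le> 2 powr (2 * real k + 1 - (s - \<epsilon>) * real r)"
      unfolding near_def using j0(2) by (intro pairs) auto
    also have "\<dots> = 2 * t / 2 powr (\<epsilon> * real r)"
      by (rule eq)
    also have "\<dots> \<le> 2 * t / 4" using r(2) t by (intro divide_left_mono) auto
    finally show ?thesis by simp
  qed
  \<comment> \<open>The near pairs and at most \<open>r\<close> classes below this threshold would
    give at most \<open>t / 2 + t / 4\<close>, which is less than \<open>t\<close>.\<close>
  define Z where "Z = (\<lambda>j. {e \<in> sphere 0 1. t / (4 * real r) \<le> real (card {q \<in> Q j. ?R e q})})"
  have finQ: "finite (Q j)" for j unfolding Q_def using G(1) by auto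
  have sub: "energy_exceptions G r t \<subseteq> (\<Union>j\<in>{j0..<r}. Z j)"
  proof
    fix e assume e: "e \<in> energy_exceptions G r t"
    show "e \<in> (\<Union>j\<in>{j0..<r}. Z j)"
    proof (rule ccontr)
      assume "\<not> ?thesis"
      then have small: "real (card {q \<in> Q j. ?R e q}) \<le> t / (4 * real r)" if "j \<in> {j0..<r}" for j
        using that e unfolding Z_def energy_exceptions_def by force
      have "{q \<in> G \<times> G. ?R e q} \<subseteq> near \<union> (\<Union>j\<in>{j0..<r}. {q \<in> Q j. ?R e q})"
      proof
        fix q assume q: "q \<in> {q \<in> G \<times> G. ?R e q}"
        have "q \<in> near \<or> (\<exists>j\<in>{j0..<r}. q \<in> Q j)"
        proof (cases "dist (fst q) (snd q) \<le> 1 / 2 ^ r")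
          case True
          then show ?thesis using q by (auto simp: near_def)
        next
          case False
          \<comment> \<open>As \<open>q\<close> is not near, \<open>r - 1\<close> satisfies the
            condition, so the least \<open>j\<close> is below \<open>r\<close>.\<close>
          define j where "j = (LEAST j. j0 \<le> j \<and> 1 / 2 ^ Suc j < dist (fst q) (snd q))"
          have ex: "j0 \<le> r - 1 \<and> 1 / 2 ^ Suc (r - 1) < dist (fst q) (snd q)" using False j0(2) by auto
          then have j: "j0 \<le> j \<and> 1 / 2 ^ Suc j < dist (fst q) (snd q)" "j \<le> r - 1"
            unfolding j_def by (rule LeastI, rule Least_le)
          have "dist (fst q) (snd q) \<le> 1 / 2 ^ j" if "j \<noteq> j0"
          proof (rule ccontr)
            assume "\<not> ?thesis"
            then have "j0 \<le> j - 1 \<and> 1 / 2 ^ Suc (j - 1) < dist (fst q) (snd q)" using j that by auto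
            then have "j \<le> j - 1" unfolding j_def by (rule Least_le)
            then show False using j that by linarith
          qed
          then have "q \<in> Q j" using q j unfolding Q_def by auto
          then show ?thesis using j j0(2) by force
        qed
        then show "q \<in> near \<union> (\<Union>j\<in>{j0..<r}. {q \<in> Q j. ?R e q})" using q by auto
      qed
      then have "card {q \<in> G \<times> G. ?R e q} \<le> card (near \<union> (\<Union>j\<in>{j0..<r}. {q \<in> Q j. ?R e q}))"
        using G(1) finQ by (intro card_mono) (auto simp: near_def)
      also have "\<dots> \<le> card near + (\<Sum>j\<in>{j0..<r}. card {q \<in> Q j. ?R e q})"
        by (intro order_trans[OF card_Un_le] add_left_mono card_UN_le) auto
      finally have "real (card {q \<in> G \<times> G. ?R e q}) \<le> real (card near) + (\<Sum>j\<in>{j0..<r}. real (card {q \<in> Q j. ?R e q}))"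
        by (simp flip: of_nat_sum of_nat_add)
      also have "\<dots> \<le> t / 2 + (\<Sum>j\<in>{j0..<r}. t / (4 * real r))"
        using card_near small by (intro add_mono sum_mono) auto
      also have "\<dots> = t / 2 + real (r - j0) * (t / (4 * real r))" by simp
      also have "\<dots> \<le> t / 2 + real r * (t / (4 * real r))"
        using t by (intro add_left_mono mult_right_mono) auto
      also have "\<dots> = 3 * t / 4" using r(1) by simp
      also have "\<dots> < t" using t by simp
      finally show False using e unfolding energy_exceptions_def by simp
    qed
  qed
  have "covered s (Z j) (ennreal (32 * 64 powr s * real r * 2 powr (- \<epsilon> * real r)))"
    if j: "j \<in> {j0..<r}" for j
  proof -
    \<comment> \<open>Pairs in \<open>Q j\<close> are more than \<open>1 / 2 ^ Suc j\<close> apart,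
      so \<open>4 / 2 ^ r\<close> is at most \<open>?a\<close> times their distance.\<close>
    let ?a = "8 * 2 ^ j / 2 ^ r :: real"
    have Q: "\<bar>e \<bullet> (fst q - snd q)\<bar> \<le> ?a * norm (fst q - snd q)" if "q \<in> Q j" "?R e q" for q e
    proof -
      have "4 / 2 ^ r = ?a * (1 / 2 ^ Suc j :: real)" by simp
      also have "\<dots> \<le> ?a * norm (fst q - snd q)"
        using that(1) by (intro mult_left_mono) (auto simp: Q_def dist_norm)
      finally show ?thesis using that(2) by linarith
    qed
    have "covered s (Z j) (ennreal (2 * real (card (Q j)) / (t / (4 * real r)) * (8 * ?a) powr s))"
    proof (rule covered_almost_orthogonal[where v = "\<lambda>q. fst q - snd q"])
      show "fst q - snd q \<noteq> 0" if "q \<in> Q j" for q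
        using that zero_le_divide_1_iff[of "2 ^ Suc j :: real"] unfolding Q_def
        by (auto simp: dist_norm)
      fix e assume e: "e \<in> Z j"
      then show "norm e = 1" by (simp add: Z_def)
      have "t / (4 * real r) \<le> real (card {q \<in> Q j. ?R e q})" using e by (simp add: Z_def)
      also have "\<dots> \<le> real (card {q \<in> Q j. \<bar>e \<bullet> (fst q - snd q)\<bar> \<le> ?a * norm (fst q - snd q)})"
        using finQ Q by (intro of_nat_mono card_mono) auto
      finally show "t / (4 * real r) \<le> real (card {q \<in> Q j. \<bar>e \<bullet> (fst q - snd q)\<bar> \<le> ?a * norm (fst q - snd q)})" .
    qed (use finQ t r s in auto)
    moreover have "2 * real (card (Q j)) / (t / (4 * real r)) * (8 * ?a) powr s
        \<le> 32 * 64 powr s * real r * 2 powr (- \<epsilon> * real r)"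
    proof -
      have "2 * real (card (Q j)) / (t / (4 * real r)) = real (card (Q j)) * (8 * real r / t)" by simp
      also have "\<dots> \<le> 2 powr (2 * real k + 2 - s * real j + \<epsilon> * real r) * (8 * real r / t)"
        using cardQ[of j] j t by (intro mult_right_mono) auto
      finally have 1: "2 * real (card (Q j)) / (t / (4 * real r)) \<le>
          2 powr (2 * real k + 2 - s * real j + \<epsilon> * real r) * (8 * real r / t)" .
      have a: "(8 * ?a) powr s = 64 powr s * 2 powr (s * (real j - real r))"
      proof -
        have "8 * ?a = 64 * 2 powr (real j - real r)" by (simp add: powr_diff powr_realpow)
        then show ?thesis by (simp add: powr_mult powr_powr mult.commute)
      qed
      have "2 powr (2 * real k + 2 - s * real j + \<epsilon> * real r) * (8 * real r / t) * (8 * ?a) powr s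
        = 8 * real r * 64 powr s * (2 powr (2 * real k + 2 - s * real j + \<epsilon> * real r) / t * 2 powr (s * (real j - real r)))"
        unfolding a by simp
      also have "2 powr (2 * real k + 2 - s * real j + \<epsilon> * real r) / t * 2 powr (s * (real j - real r))
        = 2 powr (2 - \<epsilon> * real r)"
        unfolding t_def powr_add[symmetric] powr_diff[symmetric]
        by (rule arg_cong[where f = "\<lambda>x. 2 powr x"]) (simp add: algebra_simps)
      also have "\<dots> = 4 * 2 powr (- \<epsilon> * real r)" by (simp add: powr_diff powr_minus_divide)
      finally have 2: "2 powr (2 * real k + 2 - s * real j + \<epsilon> * real r) * (8 * real r / t) * (8 * ?a) powr s
        = 32 * 64 powr s * real r * 2 powr (- \<epsilon> * real r)" by simp
      show ?thesis using mult_right_mono[OF 1, of "(8 * ?a) powr s"] 2 by simp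
    qed
    ultimately show ?thesis using covered_mono ennreal_leI by blast
  qed
  then have "covered s (\<Union>j\<in>{j0..<r}. Z j) (\<Sum>j\<in>{j0..<r}. ennreal (32 * 64 powr s * real r * 2 powr (- \<epsilon> * real r)))"
    by (intro covered_finite_UN) auto
  moreover have "(\<Sum>j\<in>{j0..<r}. ennreal (32 * 64 powr s * real r * 2 powr (- \<epsilon> * real r)))
      \<le> ennreal (32 * 64 powr s * (real r)\<^sup>2 * 2 powr (- \<epsilon> * real r))"
  proof -
    have "(\<Sum>j\<in>{j0..<r}. ennreal (32 * 64 powr s * real r * 2 powr (- \<epsilon> * real r)))
      = ennreal (\<Sum>j\<in>{j0..<r}. 32 * 64 powr s * real r * 2 powr (- \<epsilon> * real r))"
      by (rule sum_ennreal) simp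
    also have "\<dots> \<le> ennreal (real r * (32 * 64 powr s * real r * 2 powr (- \<epsilon> * real r)))"
      unfolding sum_constant card_atLeastLessThan by (intro ennreal_leI mult_right_mono) auto
    finally show ?thesis by (simp add: power2_eq_square mult_ac)
  qed
  ultimately show ?thesis using covered_mono[OF _ sub] unfolding t_def by blast
qed


section \<open>Exceptional directions\<close>

text \<open>Below the first scale no spreading is required. Counting all pairs at these distances loses
  only a factor \<open>2 powr (\<epsilon> r)\<close>, and since the scale grows with \<open>r\<close>, the net of points that are not
  spread is needed only at scales \<open>j\<close> that are comparable to \<open>r\<close>.\<close>

definition first_scale :: "real \<Rightarrow> real \<Rightarrow> nat \<Rightarrow> nat" where
  "first_scale s \<epsilon> r = nat \<lfloor>\<epsilon> * real r / s\<rfloor>"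

definition spread_points :: "otm \<Rightarrow> nat set \<Rightarrow> real \<Rightarrow> real \<Rightarrow> nat \<Rightarrow> nat \<Rightarrow> (real ^ 2) set" where
  "spread_points U A s \<epsilon> r k = {p \<in> points U A k. \<forall>j\<in>{first_scale s \<epsilon> r..r}.
     real (card (points U A k \<inter> cball p (1 / 2 ^ j))) \<le> 2 powr (real k - (s - \<epsilon>) * real j)}"

text \<open>The range of \<open>k\<close> suffices because at the point that optimality provides,
  the complexity at precision \<open>r\<close> will be at most \<open>7 * r\<close> for large
  \<open>r\<close>.\<close>

definition exceptions :: "otm \<Rightarrow> nat set \<Rightarrow> real \<Rightarrow> real \<Rightarrow> nat \<Rightarrow> (real ^ 2) set" where
  "exceptions U A s \<epsilon> r = (\<Union>k\<le>7 * r.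
     energy_exceptions (spread_points U A s \<epsilon> r k) r (2 powr (2 * real k - (s - 2 * \<epsilon>) * real r)))"

lemma covered_limsup_exceptions:
  assumes U: "universal_prefix_free_otm U" and pos: "0 < \<epsilon>" "\<epsilon> < s" and \<gamma>: "0 < \<gamma>"
  shows "covered s {e. \<exists>\<^sub>F r in sequentially. e \<in> exceptions U A s \<epsilon> r} (ennreal \<gamma>)"
proof -
  define a where "a = (\<lambda>r. real (7 * r + 1) * (32 * 64 powr s * (real r)\<^sup>2 * 2 powr (- \<epsilon> * real r)))"
  have "\<forall>\<^sub>F r in sequentially. 4 \<le> 2 powr (\<epsilon> * real r)" using pos(1) by real_asymp
  then obtain r0 where r0: "\<And>r. r \<ge> r0 \<Longrightarrow> 4 \<le> 2 powr (\<epsilon> * real r)"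
    unfolding eventually_sequentially by blast
  have "covered s (exceptions U A s \<epsilon> r) (ennreal (a r))" if r: "max r0 1 \<le> r" for r
  proof -
    have "covered s (energy_exceptions (spread_points U A s \<epsilon> r k) r (2 powr (2 * real k - (s - 2 * \<epsilon>) * real r)))
        (ennreal (32 * 64 powr s * (real r)\<^sup>2 * 2 powr (- \<epsilon> * real r)))" for k
    proof (rule covered_energy_exceptions[OF pos])
      have sub: "spread_points U A s \<epsilon> r k \<subseteq> points U A k" by (auto simp: spread_points_def)
      show "finite (spread_points U A s \<epsilon> r k)" using finite_subset[OF sub finite_points[OF U]] .
      show "card (spread_points U A s \<epsilon> r k) \<le> 2 ^ (k + 1)"
        using card_mono[OF finite_points[OF U] sub] card_points[OF U, of A k, where 'n = 2] by linarith
      fix j p assume j: "nat \<lfloor>\<epsilon> * real r / s\<rfloor> \<le> j" "j \<le> r" and p: "p \<in> spread_points U A s \<epsilon> r k"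
      have "real (card (spread_points U A s \<epsilon> r k \<inter> cball p (1 / 2 ^ j)))
          \<le> real (card (points U A k \<inter> cball p (1 / 2 ^ j)))"
        using finite_points[OF U] sub by (intro of_nat_mono card_mono) auto
      also have "\<dots> \<le> 2 powr (real k - (s - \<epsilon>) * real j)"
        using p j unfolding spread_points_def first_scale_def by auto
      finally show "real (card (spread_points U A s \<epsilon> r k \<inter> cball p (1 / 2 ^ j)))
          \<le> 2 powr (real k - (s - \<epsilon>) * real j)" .
    qed (use r r0 in auto)
    then have "covered s (exceptions U A s \<epsilon> r)
        (\<Sum>k\<le>7 * r. ennreal (32 * 64 powr s * (real r)\<^sup>2 * 2 powr (- \<epsilon> * real r)))"
      unfolding exceptions_def by (intro covered_finite_UN) auto
    also have "(\<Sum>k\<le>7 * r. ennreal (32 * 64 powr s * (real r)\<^sup>2 * 2 powr (- \<epsilon> * real r)))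
       = ennreal (\<Sum>k\<le>7 * r. 32 * 64 powr s * (real r)\<^sup>2 * 2 powr (- \<epsilon> * real r))"
      by (rule sum_ennreal) simp
    also have "\<dots> = ennreal (a r)" unfolding a_def by simp
    finally show ?thesis .
  qed
  moreover have "summable a"
  proof (rule summable_comparison_test_ev)
    \<comment> \<open>Half of the exponential decay absorbs the polynomial factor.\<close>
    have "\<forall>\<^sub>F r in sequentially. real (7 * r + 1) * (32 * 64 powr s * (real r)\<^sup>2) \<le> 2 powr (\<epsilon> / 2 * real r)"
      using pos(1) by real_asymp
    then show "\<forall>\<^sub>F r in sequentially. norm (a r) \<le> (2 powr (- \<epsilon> / 2)) ^ r"
    proof eventually_elim
      case (elim r)
      have "norm (a r) = real (7 * r + 1) * (32 * 64 powr s * (real r)\<^sup>2) * 2 powr (- \<epsilon> * real r)"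
        by (simp add: a_def)
      also have "\<dots> \<le> 2 powr (\<epsilon> / 2 * real r) * 2 powr (- \<epsilon> * real r)"
        using elim by (intro mult_right_mono) auto
      also have "\<dots> = 2 powr (- \<epsilon> / 2 * real r)"
        unfolding powr_add[symmetric] by (rule arg_cong[where f = "\<lambda>x. 2 powr x"]) simp
      also have "\<dots> = (2 powr (- \<epsilon> / 2)) ^ r" by (simp add: powr_powr flip: powr_realpow)
      finally show ?case .
    qed
    show "summable (\<lambda>r. (2 powr (- \<epsilon> / 2)) ^ r)"
      using pos(1) by (intro summable_geometric) (simp add: powr_less_one)
  qed
  moreover have "0 \<le> a r" for r by (simp add: a_def)
  ultimately show ?thesis using \<gamma> by (rule covered_limsup)
qed


section \<open>Sets encoded in the oracle\<close>

text \<open>Coordinates are rounded down to multiples of \<open>1 / 2 ^ (r + 1)\<close>, so the two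
  errors add up to less than \<open>1 / 2 ^ r\<close>. The grid supplies an a priori linear bound on
  complexities.\<close>

lemma rational_grid:
  "\<exists>g. finite g \<and> g \<subseteq> range real_vec \<and> real (card g) \<le> 2 ^ (4 * r + 6) \<and>
    (\<forall>x :: real ^ 2. norm x \<le> 2 ^ r \<longrightarrow> (\<exists>y\<in>g. dist x y < 1 / 2 ^ r))"
proof -
  define M :: int where "M = 2 ^ (2 * r + 1)"
  define f :: "int \<times> int \<Rightarrow> real ^ 2" where
    "f = (\<lambda>(a, b). real_vec (vector [of_int a / 2 ^ (r + 1), of_int b / 2 ^ (r + 1)]))"
  have f: "f (a, b) $ 1 = of_int a / 2 ^ (r + 1)" "f (a, b) $ 2 = of_int b / 2 ^ (r + 1)" for a b
    by (simp_all add: f_def real_vec_def of_rat_divide of_rat_mult of_rat_power)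
  define g where "g = f ` ({-M..M} \<times> {-M..M})"
  have "card g \<le> card ({-M..M} \<times> {-M..M})" unfolding g_def by (intro card_image_le) auto
  also have "\<dots> = nat (2 * M + 1) * nat (2 * M + 1)" by (simp add: card_cartesian_product)
  also have "\<dots> \<le> 2 ^ (2 * r + 3) * 2 ^ (2 * r + 3)"
  proof -
    have "(1 :: int) \<le> 2 ^ (2 * r)" by simp
    moreover have "M = 2 * 2 ^ (2 * r)" "(2 :: int) ^ (2 * r + 3) = 8 * 2 ^ (2 * r)"
      by (simp_all add: M_def power_add)
    ultimately have "2 * M + 1 \<le> 2 ^ (2 * r + 3)" by linarith
    then have "nat (2 * M + 1) \<le> 2 ^ (2 * r + 3)" by (simp add: nat_le_iff)
    then show ?thesis by (intro mult_mono) auto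
  qed
  also have "\<dots> = 2 ^ (4 * r + 6)" unfolding power_add[symmetric] by (rule arg_cong[where f = "\<lambda>x. 2 ^ x"]) simp
  finally have "card g \<le> 2 ^ (4 * r + 6)" .
  then have card: "real (card g) \<le> 2 ^ (4 * r + 6)" by (metis of_nat_le_iff of_nat_numeral of_nat_power)
  have "\<exists>y\<in>g. dist x y < 1 / 2 ^ r" if x: "norm x \<le> 2 ^ r" for x :: "real ^ 2"
  proof -
    define a where "a = (\<lambda>i. \<lfloor>x $ i * 2 ^ (r + 1)\<rfloor>)"
    have a: "a i \<in> {-M..M}" for i
    proof -
      have "\<bar>x $ i\<bar> \<le> 2 ^ r" using component_le_norm_cart[of x i] x by linarith
      then have "\<bar>x $ i * 2 ^ (r + 1)\<bar> \<le> 2 ^ r * 2 ^ (r + 1)" by (simp add: abs_mult)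
      also have "\<dots> = of_int M" 
        unfolding M_def power_add[symmetric] of_int_power of_int_numeral
        by (rule arg_cong[where f = "\<lambda>n. 2 ^ n"]) simp
      finally show ?thesis unfolding a_def by (auto simp: le_floor_iff floor_le_iff)
    qed
    have d: "\<bar>(x - f (a 1, a 2)) $ i\<bar> < 1 / 2 ^ (r + 1)" for i
    proof -
      have "\<bar>x $ i - of_int (a i) / 2 ^ (r + 1)\<bar> = (x $ i * 2 ^ (r + 1) - of_int (a i)) / 2 ^ (r + 1)"
        unfolding a_def by (simp add: field_simps)
      also have "\<dots> < 1 / 2 ^ (r + 1)"
        unfolding a_def by (intro divide_strict_right_mono) (linarith, simp)
      finally show ?thesis using f exhaust_2[of i] by auto
    qed
    have "dist x (f (a 1, a 2)) \<le> (\<Sum>i\<in>UNIV. \<bar>(x - f (a 1, a 2)) $ i\<bar>)"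
      unfolding dist_norm by (rule norm_le_l1_cart)
    also have "\<dots> < 1 / 2 ^ (r + 1) + 1 / 2 ^ (r + 1)" unfolding sum_2 using d by (intro add_strict_mono) auto
    also have "\<dots> = 1 / 2 ^ r" by simp
    finally show ?thesis using a unfolding g_def by blast
  qed
  moreover have "g \<subseteq> range real_vec" unfolding g_def f_def by auto
  moreover have "finite g" unfolding g_def by auto
  ultimately show ?thesis using card by blast
qed

text \<open>For fixed \<open>j\<close> and \<open>k\<close> there are at most
  \<open>2 powr (1 + (s - \<epsilon>) * j)\<close> centres, and the number of relevant
  \<open>k\<close> is linear in \<open>j\<close>. The exponent is split into an index of about
  \<open>(s - \<epsilon> / 2) * j\<close> bits and the decay required by
  \<open>table_coding_powr\<close>.\<close>

lemma concentrated_points_net: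
  assumes U: "universal_prefix_free_otm U" and pos: "0 < \<epsilon>" "\<epsilon> < s" and s: "s \<le> 1"
  shows "\<exists>N j1. (\<forall>j. finite (N j) \<and> N j \<subseteq> range (real_vec :: _ \<Rightarrow> real ^ 2) \<and>
      real (card (N j)) \<le> 2 powr ((s - \<epsilon> / 2) * real j - \<epsilon> / 8 * real j)) \<and>
    (\<forall>j r k p. j1 \<le> j \<longrightarrow> first_scale s \<epsilon> r \<le> j \<longrightarrow> j \<le> r \<longrightarrow> k \<le> 7 * r \<longrightarrow> p \<in> points U A k \<longrightarrow>
      2 powr (real k - (s - \<epsilon>) * real j) < real (card (points U A k \<inter> cball p (1 / 2 ^ j))) \<longrightarrow>
      (\<exists>y\<in>N j. dist y p \<le> 2 / 2 ^ j))"
proof -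
  define Q where "Q = (\<lambda>j k Y. Y \<subseteq> (points U A k :: (real ^ 2) set) \<and>
    real (card Y) * 2 powr (real k - (s - \<epsilon>) * real j) \<le> real (card (points U A k :: (real ^ 2) set)) \<and>
    (\<forall>p\<in>points U A k. 2 powr (real k - (s - \<epsilon>) * real j) < real (card (points U A k \<inter> cball p (1 / 2 ^ j))) \<longrightarrow>
       (\<exists>y\<in>Y. dist y p \<le> 2 * (1 / 2 ^ j))))"
  have "\<exists>Y. Q j k Y" for j k
    unfolding Q_def by (rule dense_points_net) (auto simp: finite_points[OF U])
  then obtain Y where "\<And>j k. Q j k (Y j k)" by metis
  then have Y: "\<And>j k. Y j k \<subseteq> (points U A k :: (real ^ 2) set)"
    "\<And>j k. real (card (Y j k)) * 2 powr (real k - (s - \<epsilon>) * real j) \<le> real (card (points U A k :: (real ^ 2) set))"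
    "\<And>j k p. p \<in> points U A k \<Longrightarrow>
       2 powr (real k - (s - \<epsilon>) * real j) < real (card (points U A k \<inter> cball p (1 / 2 ^ j))) \<Longrightarrow>
       \<exists>y\<in>Y j k. dist y p \<le> 2 * (1 / 2 ^ j)" unfolding Q_def by blast+
  have cardY: "real (card (Y j k)) \<le> 2 powr (1 + (s - \<epsilon>) * real j)" for j k
  proof -
    have "real (card (points U A k :: (real ^ 2) set)) \<le> real (2 ^ (k + 1))"
      using card_points[OF U] by (intro of_nat_mono)
    also have "\<dots> = 2 powr (1 + real k)" by (simp add: powr_add powr_realpow)
    finally have "real (card (Y j k)) * 2 powr (real k - (s - \<epsilon>) * real j) \<le> 2 powr (1 + real k)"
      using Y(2)[of j k] by linarith
    then have "real (card (Y j k)) \<le> 2 powr (1 + real k) / 2 powr (real k - (s - \<epsilon>) * real j)"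
      by (simp add: pos_le_divide_eq)
    then show ?thesis by (simp flip: powr_diff)
  qed
  \<comment> \<open>From \<open>first_scale s \<epsilon> r \<le> j\<close> and
    \<open>s \<le> 1\<close> it follows that \<open>r \<le> R j\<close>, so a single
    \<open>N j\<close> can serve all such \<open>r\<close>.\<close>
  define R where "R = (\<lambda>j. nat \<lceil>(real j + 1) / \<epsilon>\<rceil>)"
  have R: "real (R j) \<le> (real j + 1) / \<epsilon> + 1" for j
    using pos(1) unfolding R_def by (simp add: ceiling_le_iff of_nat_nat)
  have "\<forall>\<^sub>F j in sequentially. (7 * ((real j + 1) / \<epsilon> + 1) + 1) * 2 \<le> 2 powr (3 * \<epsilon> / 8 * real j)"
    using pos(1) by real_asymp
  then obtain j1 where j1: "\<And>j. j \<ge> j1 \<Longrightarrow> (7 * ((real j + 1) / \<epsilon> + 1) + 1) * 2 \<le> 2 powr (3 * \<epsilon> / 8 * real j)"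
    unfolding eventually_sequentially by blast
  define N where "N = (\<lambda>j. if j < j1 then {} else \<Union>k\<le>7 * R j. Y j k)"
  have finY: "finite (Y j k)" for j k using Y(1) finite_points[OF U] finite_subset by blast
  have "finite (N j)" for j unfolding N_def using finY by auto
  moreover have "N j \<subseteq> range real_vec" for j
  proof -
    have "Y j k \<subseteq> range real_vec" for k using Y(1)[of j k] unfolding points_def by blast
    then show ?thesis unfolding N_def by auto
  qed
  moreover have "real (card (N j)) \<le> 2 powr ((s - \<epsilon> / 2) * real j - \<epsilon> / 8 * real j)" for j
  proof (cases "j < j1")
    case False
    have "real (card (N j)) \<le> (\<Sum>k\<le>7 * R j. real (card (Y j k)))"
      using False card_UN_le[of "{..7 * R j}" "Y j"] unfolding N_def by (simp flip: of_nat_sum)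
    also have "\<dots> \<le> (\<Sum>k\<le>7 * R j. 2 powr (1 + (s - \<epsilon>) * real j))" using cardY by (intro sum_mono)
    also have "\<dots> = (7 * real (R j) + 1) * 2 * 2 powr ((s - \<epsilon>) * real j)" by (simp add: powr_add)
    also have "\<dots> \<le> (7 * ((real j + 1) / \<epsilon> + 1) + 1) * 2 * 2 powr ((s - \<epsilon>) * real j)"
      by (intro mult_right_mono add_right_mono mult_left_mono R) simp_all
    also have "\<dots> \<le> 2 powr (3 * \<epsilon> / 8 * real j) * 2 powr ((s - \<epsilon>) * real j)"
      using j1[of j] False by (intro mult_right_mono) auto
    also have "\<dots> = 2 powr ((s - \<epsilon> / 2) * real j - \<epsilon> / 8 * real j)"
      unfolding powr_add[symmetric] by (rule arg_cong[where f = "\<lambda>x. 2 powr x"]) (simp add: algebra_simps)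
    finally show ?thesis .
  qed (simp add: N_def)
  moreover have "\<exists>y\<in>N j. dist y p \<le> 2 / 2 ^ j"
    if *: "j1 \<le> j" "first_scale s \<epsilon> r \<le> j" "j \<le> r" "k \<le> 7 * r" "p \<in> points U A k"
      "2 powr (real k - (s - \<epsilon>) * real j) < real (card (points U A k \<inter> cball p (1 / 2 ^ j)))" for j r k p
  proof -
    have "\<epsilon> * real r / s < real j + 1" using *(2) unfolding first_scale_def by linarith
    then have "\<epsilon> * real r < (real j + 1) * s" using pos by (simp add: pos_divide_less_eq)
    also have "\<dots> \<le> (real j + 1) * 1" using s by (intro mult_left_mono) auto
    finally have "real r \<le> (real j + 1) / \<epsilon>" using pos(1) by (simp add: field_simps)
    then have "r \<le> R j" unfolding R_def by linarith
    then have "k \<in> {..7 * R j}" using *(4) by simp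
    then have "Y j k \<subseteq> N j" using *(1) unfolding N_def by auto
    then show ?thesis using Y(3)[OF *(5,6)] by auto
  qed
  ultimately show ?thesis by (intro exI[of _ N] exI[of _ j1]) blast
qed

text \<open>These points will receive short codes: they lie in a tube over the cover
  \<open>T\<close> or in a heavy tube.\<close>

definition short_points :: "(real ^ 2) set \<Rightarrow> real ^ 2 \<Rightarrow> real set \<Rightarrow> nat \<Rightarrow> real \<Rightarrow> (real ^ 2) set" where
  "short_points G e T r m = {p \<in> G. (\<exists>c\<in>T. \<bar>e \<bullet> p - c\<bar> \<le> 2 / 2 ^ r) \<or>
     m < real (card {p' \<in> G. \<bar>e \<bullet> (p - p')\<bar> \<le> 4 / 2 ^ r})}"

text \<open>A heavy point accounts for more than \<open>m\<close> close pairs, of which there are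
  fewer than \<open>m * n\<close>, so at most \<open>n\<close> points are heavy. The light points
  near one centre all lie in the tube of any one of them, so there are at most
  \<open>m\<close>.\<close>

lemma card_short_points:
  assumes G: "finite G" and T: "finite T" and m: "0 < m" and e: "norm e = 1" "e \<notin> energy_exceptions G r (m * n)"
  shows "real (card (short_points G e T r m)) \<le> n + m * real (card T)"
proof -
  let ?F = "\<lambda>p. {p' \<in> G. \<bar>e \<bullet> (p - p')\<bar> \<le> 4 / 2 ^ r}"
  define H where "H = {p \<in> G. m < real (card (?F p))}"
  define L where "L = (\<lambda>c. {p \<in> G - H. \<bar>e \<bullet> p - c\<bar> \<le> 2 / 2 ^ r})"
  have "m * real (card H) = (\<Sum>p\<in>H. m)" by simp
  also have "\<dots> \<le> (\<Sum>p\<in>H. real (card (?F p)))" unfolding H_def by (intro sum_mono) auto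
  also have "\<dots> \<le> (\<Sum>p\<in>G. real (card (?F p)))" using G unfolding H_def by (intro sum_mono2) auto
  also have "\<dots> = real (card (SIGMA p:G. ?F p))" using G by simp
  also have "(SIGMA p:G. ?F p) = {q \<in> G \<times> G. \<bar>e \<bullet> (fst q - snd q)\<bar> \<le> 4 / 2 ^ r}" by auto
  also have "real (card \<dots>) \<le> m * n" using e unfolding energy_exceptions_def by force
  finally have H: "real (card H) \<le> n" using m by simp
  have L: "real (card (L c)) \<le> m" for c
  proof (cases "L c = {}")
    case False
    then obtain p where p: "p \<in> L c" by blast
    have "L c \<subseteq> ?F p"
    proof
      fix p' assume p': "p' \<in> L c"
      have "\<bar>e \<bullet> (p - p')\<bar> \<le> \<bar>e \<bullet> p - c\<bar> + \<bar>e \<bullet> p' - c\<bar>" unfolding inner_diff_right by linarith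
      also have "\<dots> \<le> 2 / 2 ^ r + 2 / 2 ^ r" using p p' unfolding L_def by (intro add_mono) auto
      finally show "p' \<in> ?F p" using p' unfolding L_def by simp
    qed
    then have "card (L c) \<le> card (?F p)" using G by (intro card_mono) auto
    also have "real (card (?F p)) \<le> m" using p unfolding L_def H_def by auto
    finally show ?thesis by simp
  qed (use m in simp)
  have "short_points G e T r m \<subseteq> H \<union> (\<Union>c\<in>T. L c)" unfolding short_points_def H_def L_def by blast
  then have "card (short_points G e T r m) \<le> card (H \<union> (\<Union>c\<in>T. L c))"
    using G T unfolding H_def L_def by (intro card_mono) auto
  also have "\<dots> \<le> card H + (\<Sum>c\<in>T. card (L c))"
    using T by (intro order_trans[OF card_Un_le] add_left_mono card_UN_le) auto
  finally have "real (card (short_points G e T r m)) \<le> real (card H) + (\<Sum>c\<in>T. real (card (L c)))"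
    by (simp flip: of_nat_sum of_nat_add)
  also have "\<dots> \<le> n + (\<Sum>c\<in>T. m)" using H L by (intro add_mono sum_mono) auto
  finally show ?thesis by (simp add: mult.commute)
qed


section \<open>Projections in non-exceptional directions\<close>

lemma eventually_gt_effective_dim:
  assumes "ennreal s < effective_dim U A x + ennreal \<delta>" "0 \<le> \<delta>" "\<delta> \<le> s"
  shows "\<forall>\<^sub>F r in sequentially. (s - \<delta>) * real r \<le> real (complexity_at U A r x)"
proof -
  have "ennreal (s - \<delta>) < effective_dim U A x"
  proof (rule ccontr)
    assume "\<not> ?thesis"
    then have "effective_dim U A x + ennreal \<delta> \<le> ennreal (s - \<delta>) + ennreal \<delta>" by (intro add_right_mono) simp
    also have "\<dots> = ennreal s" using assms(2,3) by (simp flip: ennreal_plus)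
    finally show False using assms(1) by simp
  qed
  then have "\<forall>\<^sub>F r in sequentially. ennreal (s - \<delta>) < ennreal (real (complexity_at U A r x) / real r)"
    unfolding effective_dim_def by (rule less_LiminfD)
  then show ?thesis
  proof eventually_elim
    case (elim r)
    then have lt: "s - \<delta> < real (complexity_at U A r x) / real r"
      using assms(3) by (simp add: ennreal_less_iff)
    then have "r \<noteq> 0" using assms(3) by (intro notI) simp
    then show ?case using lt by (simp add: field_simps)
  qed
qed

text \<open>Otherwise the sets \<open>H r k\<close> are small for large \<open>r\<close>.
  Optimality, applied to an oracle \<open>B\<close> that lists them, the nets and a grid, yields a
  point \<open>x\<close> whose projection avoids the intervals of \<open>T r\<close> for all large
  \<open>r\<close>, although it must meet them infinitely often.\<close>

lemma frequently_exceptions: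
  assumes U: "universal_prefix_free_otm U" and A: "hausdorff_optimal U A E"
    and s: "s \<le> 1" "ennreal s \<le> hausdorff_dim E" and pos: "0 < \<epsilon>" "\<epsilon> < s"
    and e: "norm e = 1" and proj: "hausdorff_dim ((\<lambda>x. e \<bullet> x) ` E) < ennreal (s - 5 * \<epsilon>)"
  shows "\<exists>\<^sub>F r in sequentially. e \<in> exceptions U A s \<epsilon> r"
proof (rule ccontr)
  assume "\<not> ?thesis"
  then obtain r0 where r0: "\<And>r. r0 \<le> r \<Longrightarrow> e \<notin> exceptions U A s \<epsilon> r"
    unfolding not_frequently eventually_sequentially by blast
  obtain T where T: "\<And>r. finite (T r)" "\<And>r. real (card (T r)) \<le> 2 powr ((s - 5 * \<epsilon>) * real r)"
    "\<And>x. x \<in> E \<Longrightarrow> \<exists>\<^sub>F r in sequentially. \<exists>c\<in>T r. \<bar>e \<bullet> x - c\<bar> \<le> 1 / 2 ^ r"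
    using cover_by_dyadic_intervals[OF proj] by auto
  have "\<exists>g. finite g \<and> g \<subseteq> range real_vec \<and> real (card g) \<le> 2 ^ (4 * r + 6) \<and>
    (\<forall>x :: real ^ 2. norm x \<le> 2 ^ r \<longrightarrow> (\<exists>y\<in>g. dist x y < 1 / 2 ^ r))" for r
    by (rule rational_grid)
  then obtain g where g: "\<And>r. finite (g r)" "\<And>r. g r \<subseteq> range real_vec" "\<And>r. real (card (g r)) \<le> 2 ^ (4 * r + 6)"
    "\<And>r x :: real ^ 2. norm x \<le> 2 ^ r \<Longrightarrow> \<exists>y\<in>g r. dist x y < 1 / 2 ^ r" by metis
  obtain N j1 where N: "\<And>j. finite (N j)" "\<And>j. N j \<subseteq> range (real_vec :: _ \<Rightarrow> real ^ 2)"
      "\<And>j. real (card (N j)) \<le> 2 powr ((s - \<epsilon> / 2) * real j - \<epsilon> / 8 * real j)"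
    and net: "\<And>j r k p. j1 \<le> j \<Longrightarrow> first_scale s \<epsilon> r \<le> j \<Longrightarrow> j \<le> r \<Longrightarrow> k \<le> 7 * r \<Longrightarrow> p \<in> points U A k \<Longrightarrow>
      2 powr (real k - (s - \<epsilon>) * real j) < real (card (points U A k \<inter> cball p (1 / 2 ^ j))) \<Longrightarrow>
      \<exists>y\<in>N j. dist y p \<le> 2 / 2 ^ j"
    using concentrated_points_net[OF U pos s(1), of A] by blast
  \<comment> \<open>With this choice \<open>m r k * 2 powr (k - \<epsilon> * r)\<close> is the
    energy threshold of \<open>exceptions\<close>, while \<open>m r k * card (T r)\<close> is at
    most \<open>2 powr (k - 2 * \<epsilon> * r)\<close>.\<close>
  define m where "m = (\<lambda>r k :: nat. 2 powr (real k - (s - 3 * \<epsilon>) * real r))"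
  define H where "H = (\<lambda>r k. short_points (spread_points U A s \<epsilon> r k) e (T r) r (m r k))"
  have spread: "spread_points U A s \<epsilon> r k \<subseteq> points U A k" for r k by (auto simp: spread_points_def)
  have finspread: "finite (spread_points U A s \<epsilon> r k)" for r k
    using finite_subset[OF spread finite_points[OF U]] .
  have H_sub: "H r k \<subseteq> points U A k" for r k unfolding H_def short_points_def using spread by blast
  have finH: "finite (H r k)" for r k using finite_subset[OF H_sub finite_points[OF U]] .
  have cardH: "real (card (H r k)) \<le> 2 * 2 powr (real k - \<epsilon> * real r)" if "r0 \<le> r" "k \<le> 7 * r" for r k
  proof -
    have mn: "m r k * 2 powr (real k - \<epsilon> * real r) = 2 powr (2 * real k - (s - 2 * \<epsilon>) * real r)"
      unfolding m_def powr_add[symmetric] by (rule arg_cong[where f = "\<lambda>x. 2 powr x"]) (simp add: algebra_simps)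
    have "real (card (H r k)) \<le> 2 powr (real k - \<epsilon> * real r) + m r k * real (card (T r))"
      unfolding H_def
    proof (rule card_short_points[OF finspread T(1) _ e])
      show "0 < m r k" by (simp add: m_def)
      show "e \<notin> energy_exceptions (spread_points U A s \<epsilon> r k) r (m r k * 2 powr (real k - \<epsilon> * real r))"
        using r0[OF that(1)] that(2) unfolding mn exceptions_def by blast
    qed
    also have "m r k * real (card (T r)) \<le> m r k * 2 powr ((s - 5 * \<epsilon>) * real r)"
      using T(2) by (intro mult_left_mono) (simp_all add: m_def)
    also have "\<dots> = 2 powr (real k - 2 * \<epsilon> * real r)"
      unfolding m_def powr_add[symmetric] by (rule arg_cong[where f = "\<lambda>x. 2 powr x"]) (simp add: algebra_simps)
    also have "\<dots> \<le> 2 powr (real k - \<epsilon> * real r)" using pos(1) by (intro powr_mono) auto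
    finally show ?thesis by simp
  qed
  \<comment> \<open>Of the gain of \<open>\<epsilon> * r\<close> bits for a point of
    \<open>H r k\<close>, half shortens its code; the rest keeps the cardinalities summable over
    \<open>r\<close>.\<close>
  define h where "h = (\<lambda>r. nat \<lfloor>\<epsilon> * real r / 2\<rfloor>)"
  have h: "real (h r) \<le> \<epsilon> * real r / 2" "\<epsilon> * real r / 2 < real (h r) + 1" for r
    using pos(1) unfolding h_def by (simp_all add: of_nat_floor) linarith
  define b where "b = (\<lambda>j. nat \<lceil>(s - \<epsilon> / 2) * real j\<rceil>)"
  have b: "(s - \<epsilon> / 2) * real j \<le> real (b j)" "real (b j) \<le> (s - \<epsilon> / 2) * real j + 1" for j
  proof -
    have "0 \<le> (s - \<epsilon> / 2) * real j" using pos by simp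
    then show "(s - \<epsilon> / 2) * real j \<le> real (b j)" "real (b j) \<le> (s - \<epsilon> / 2) * real j + 1"
      unfolding b_def by linarith+
  qed
  \<comment> \<open>The three parts of the table. The grid \<open>S1\<close> gives \<open>K\<^sub>r(x) \<le> 7 r\<close>. The nets \<open>S2\<close> show that the
    approximations of \<open>x\<close> are spread, as otherwise the dimension of \<open>x\<close> relative to \<open>A\<close> and \<open>B\<close> would
    be too small. The points \<open>S3\<close> violate the second condition of optimality.\<close>
  define S1 where "S1 = (\<lambda>r l. if l = 6 * r + 7 then g r else {})"
  define S2 where "S2 = (\<lambda>j l. if l = b j then N j else {})"
  define S3 where "S3 = (\<lambda>r l. if r0 \<le> r \<and> l + h r \<le> 7 * r then H r (l + h r) else {})"
  let ?v = "\<lambda>r l :: nat. 2 powr (real l - \<epsilon> / 8 * real r)"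
  have c1: "real (card (S1 r l)) \<le> ?v r l" for r l
  proof (cases "l = 6 * r + 7")
    case True
    have "real (card (S1 r l)) \<le> 2 ^ (4 * r + 6)" using g(3) True by (simp add: S1_def)
    also have "\<dots> = 2 powr (4 * real r + 6)" by (simp flip: powr_realpow)
    also have "\<dots> \<le> ?v r l"
    proof (intro powr_mono)
      have "\<epsilon> / 8 * real r \<le> 1 * real r" using pos s(1) by (intro mult_right_mono) auto
      then show "4 * real r + 6 \<le> real l - \<epsilon> / 8 * real r" using True by simp
    qed simp
    finally show ?thesis .
  qed (simp add: S1_def)
  have c2: "real (card (S2 j l)) \<le> ?v j l" for j l
  proof (cases "l = b j")
    case True
    have "real (card (S2 j l)) \<le> 2 powr ((s - \<epsilon> / 2) * real j - \<epsilon> / 8 * real j)"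
      using N(3) True by (simp add: S2_def)
    also have "\<dots> \<le> ?v j l" using True b(1)[of j] by (intro powr_mono) auto
    finally show ?thesis .
  qed (simp add: S2_def)
  have c3: "real (card (S3 r l)) \<le> 2 * ?v r l" for r l
  proof (cases "r0 \<le> r \<and> l + h r \<le> 7 * r")
    case True
    have "real (card (S3 r l)) \<le> 2 * 2 powr (real (l + h r) - \<epsilon> * real r)"
      using cardH[of r "l + h r"] True by (simp add: S3_def)
    also have "\<dots> \<le> 2 * ?v r l"
    proof (intro mult_left_mono powr_mono)
      have "0 \<le> \<epsilon> * real r" using pos by simp
      then show "real (l + h r) - \<epsilon> * real r \<le> real l - \<epsilon> / 8 * real r"
        using h(1)[of r] by simp
    qed simp_all
    finally show ?thesis .
  qed (auto simp: S3_def)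
  define S where "S = (\<lambda>r l. S1 r l \<union> S2 r l \<union> S3 r l)"
  have "\<exists>B c. \<forall>A r l y \<rho> x. y \<in> S r l \<longrightarrow> dist x y < 1 / 2 ^ \<rho> \<longrightarrow>
    real (complexity_at U (oracle_join A B) \<rho> x) \<le> (1 + \<epsilon> / 100) * real l + c"
  proof (rule table_coding_powr[OF U])
    fix r l
    show "finite (S r l)" unfolding S_def S1_def S2_def S3_def using g(1) N(1) finH by auto
    have "H r k \<subseteq> range real_vec" for r k using H_sub[of r k] unfolding points_def by blast
    then show "S r l \<subseteq> range real_vec" unfolding S_def S1_def S2_def S3_def using g(2) N(2) by simp
    have "card (S r l) \<le> card (S1 r l) + card (S2 r l) + card (S3 r l)"
      unfolding S_def by (meson add_le_mono card_Un_le le_refl order_trans)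
    then show "real (card (S r l)) \<le> 4 * 2 powr (real l - \<epsilon> / 8 * real r)"
      using c1[of r l] c2[of r l] c3[of r l] by linarith
  qed (use pos in auto)
  then obtain B c where code: "\<And>A r l y \<rho> x. y \<in> S r l \<Longrightarrow> dist x y < 1 / 2 ^ \<rho> \<Longrightarrow>
    real (complexity_at U (oracle_join A B) \<rho> x) \<le> (1 + \<epsilon> / 100) * real l + c" by blast
  obtain x where x: "x \<in> E" "hausdorff_dim E < effective_dim U (oracle_join A B) x + ennreal (\<epsilon> / 8)"
      "\<forall>\<^sub>F r in sequentially. real (complexity_at U (oracle_join A B) r x)
                \<ge> real (complexity_at U A r x) - \<epsilon> / 8 * real r"
    using A pos(1) unfolding hausdorff_optimal_def by (meson divide_pos_pos zero_less_numeral)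
  let ?K = "\<lambda>r. real (complexity_at U A r x)"
  let ?KB = "\<lambda>r. real (complexity_at U (oracle_join A B) r x)"
  have "\<forall>\<^sub>F r in sequentially. (s - \<epsilon> / 8) * real r \<le> ?KB r"
    using s(2) x(2) pos by (intro eventually_gt_effective_dim) auto
  then obtain J where J: "\<And>r. J \<le> r \<Longrightarrow> (s - \<epsilon> / 8) * real r \<le> ?KB r"
    unfolding eventually_sequentially by blast
  \<comment> \<open>A grid point has index \<open>6 * r + 7\<close>, which bounds the complexity
    relative to \<open>A\<close> and \<open>B\<close>. The second condition of optimality carries
    the bound over to \<open>A\<close> alone.\<close>
  have upper: "\<forall>\<^sub>F r in sequentially. ?K r \<le> 7 * real r"
  proof -
    have 1: "\<forall>\<^sub>F r in sequentially. norm x \<le> 2 ^ r" by real_asymp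
    have 2: "\<forall>\<^sub>F r in sequentially. (1 + 1 / 100) * real (6 * r + 7) + c + 1 / 8 * real r \<le> 7 * real r"
      by real_asymp
    from x(3) 1 2 show ?thesis
    proof eventually_elim
      case (elim r)
      obtain y where y: "y \<in> g r" "dist x y < 1 / 2 ^ r" using g(4)[OF elim(2)] by blast
      then have "y \<in> S r (6 * r + 7)" by (simp add: S_def S1_def)
      from code[OF this y(2), of A] have "?KB r \<le> (1 + \<epsilon> / 100) * real (6 * r + 7) + c" .
      also have "(1 + \<epsilon> / 100) * real (6 * r + 7) \<le> (1 + 1 / 100) * real (6 * r + 7)"
        using pos s(1) by (intro mult_right_mono) auto
      finally have "?K r \<le> (1 + 1 / 100) * real (6 * r + 7) + c + \<epsilon> / 8 * real r"
        using elim(1) by linarith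
      moreover have "\<epsilon> / 8 * real r \<le> 1 / 8 * real r" using pos s(1) by (intro mult_right_mono) auto
      ultimately show ?case using elim(3) by linarith
    qed
  qed
  have "\<forall>\<^sub>F j in sequentially. 2 + (1 + \<epsilon> / 100) + c < (\<epsilon> / 4) * real j" using pos(1) by real_asymp
  then obtain J' where J': "\<And>j. J' \<le> j \<Longrightarrow> 2 + (1 + \<epsilon> / 100) + c < (\<epsilon> / 4) * real j"
    unfolding eventually_sequentially by blast
  \<comment> \<open>A net point this close describes \<open>x\<close> to precision
    \<open>j - 2\<close> with about \<open>(s - \<epsilon> / 2) * j\<close> bits, fewer than the
    \<open>(s - \<epsilon> / 8) * (j - 2)\<close> bits that \<open>J\<close> requires.\<close>
  have not_net: False if j: "max (J + 2) J' \<le> j" and y: "y \<in> N j" "dist x y < 4 / 2 ^ j" for j y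
  proof -
    obtain i where i: "j = i + 2" using j by (metis add.commute le_Suc_ex le_add2 max.bounded_iff order_trans)
    have "y \<in> S j (b j)" using y(1) by (simp add: S_def S2_def)
    moreover have "dist x y < 1 / 2 ^ i" using y(2) by (simp add: i)
    ultimately have "?KB i \<le> (1 + \<epsilon> / 100) * real (b j) + c" by (rule code)
    also have "\<dots> \<le> (1 + \<epsilon> / 100) * ((s - \<epsilon> / 2) * real j + 1) + c"
      using b(2)[of j] pos(1) by (intro add_right_mono mult_left_mono) auto
    finally have 1: "(s - \<epsilon> / 8) * (real j - 2) \<le> (1 + \<epsilon> / 100) * ((s - \<epsilon> / 2) * real j + 1) + c"
      using J[of i] j i by simp
    define X where "X = (s - \<epsilon> / 2) * real j"
    define W where "W = \<epsilon> * real j"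
    have "(s - \<epsilon> / 8) * (real j - 2) = X + 3 / 8 * W - 2 * s + \<epsilon> / 4"
      unfolding X_def W_def by (simp add: field_simps)
    moreover have "(1 + \<epsilon> / 100) * (X + 1) = X + \<epsilon> / 100 * X + 1 + \<epsilon> / 100"
      by (simp add: algebra_simps)
    moreover have "\<epsilon> / 100 * X \<le> \<epsilon> / 100 * real j"
    proof (intro mult_left_mono)
      have "X \<le> 1 * real j" unfolding X_def using pos s(1) by (intro mult_right_mono) auto
      then show "X \<le> real j" by simp
    qed (use pos in simp)
    then have "\<epsilon> / 100 * X \<le> W / 100" unfolding W_def by simp
    moreover have "0 \<le> W" using pos unfolding W_def by simp
    moreover have "2 + (1 + \<epsilon> / 100) + c < W / 4" using J'[of j] j unfolding W_def by simp
    ultimately show False using 1 pos s(1) unfolding X_def[symmetric] by linarith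
  qed
  \<comment> \<open>\<open>first_scale\<close> tends to infinity with \<open>r\<close>, so every
    scale tested for spreading is large enough for \<open>net\<close> and
    \<open>not_net\<close>.\<close>
  have scale: "\<forall>\<^sub>F r in sequentially. max (max (J + 2) J') j1 \<le> first_scale s \<epsilon> r"
  proof -
    let ?M = "max (max (J + 2) J') j1"
    have "\<forall>\<^sub>F r in sequentially. real ?M \<le> \<epsilon> * real r / s" using pos by real_asymp
    then show ?thesis
    proof eventually_elim
      case (elim r)
      then show ?case unfolding first_scale_def by linarith
    qed
  qed
  have small: "\<forall>\<^sub>F r in sequentially. 2 / \<epsilon> < real r" "\<forall>\<^sub>F r in sequentially. 2 + c < \<epsilon> / 4 * real r"
    using pos(1) by real_asymp+
  have "\<forall>\<^sub>F r in sequentially. \<not> (\<exists>c\<in>T r. \<bar>e \<bullet> x - c\<bar> \<le> 1 / 2 ^ r)"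
    using x(3) upper scale small eventually_ge_at_top[of r0]
  proof eventually_elim
    case (elim r)
    show ?case
    proof
      assume "\<exists>c\<in>T r. \<bar>e \<bullet> x - c\<bar> \<le> 1 / 2 ^ r"
      then obtain z where z: "z \<in> T r" "\<bar>e \<bullet> x - z\<bar> \<le> 1 / 2 ^ r" by blast
      define k where "k = complexity_at U A r x"
      have k: "k \<le> 7 * r" using elim(2) unfolding k_def by linarith
      obtain p where p: "p \<in> points U A k" "dist x p < 1 / 2 ^ r"
        using complexity_at_attained[OF U, of A r x] unfolding k_def by blast
      \<comment> \<open>Otherwise a crowded ball around \<open>p\<close> at some scale
        \<open>j\<close> provides a net point within \<open>4 / 2 ^ j\<close> of
        \<open>x\<close>.\<close>
      have "p \<in> spread_points U A s \<epsilon> r k"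
      proof (rule ccontr)
        assume "p \<notin> spread_points U A s \<epsilon> r k"
        then obtain j where j: "first_scale s \<epsilon> r \<le> j" "j \<le> r"
          "2 powr (real k - (s - \<epsilon>) * real j) < real (card (points U A k \<inter> cball p (1 / 2 ^ j)))"
          using p(1) unfolding spread_points_def by force
        have "j1 \<le> j" "max (J + 2) J' \<le> j" using elim(3) j(1) by simp_all
        obtain y where y: "y \<in> N j" "dist y p \<le> 2 / 2 ^ j"
          using net[OF \<open>j1 \<le> j\<close> j(1,2) k p(1) j(3)] by blast
        have "(1 :: real) / 2 ^ r \<le> 1 / 2 ^ j" using j(2) by (simp add: frac_le)
        then have "dist x y < 1 / 2 ^ j + 2 / 2 ^ j"
          using dist_triangle[of x y p] p(2) y(2) by (simp add: dist_commute)
        also have "\<dots> \<le> 4 / 2 ^ j" by (simp add: field_simps)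
        finally show False using not_net[OF \<open>max (J + 2) J' \<le> j\<close> y(1)] by blast
      qed
      moreover have "\<bar>e \<bullet> p - z\<bar> \<le> 2 / 2 ^ r"
      proof -
        have "\<bar>e \<bullet> (p - x)\<bar> \<le> norm e * norm (p - x)" by (rule Cauchy_Schwarz_ineq2)
        also have "\<dots> \<le> 1 / 2 ^ r" using e p(2) by (simp add: dist_norm norm_minus_commute)
        finally show ?thesis using z(2) by (simp add: inner_diff_right)
      qed
      ultimately have pH: "p \<in> H r k" using z(1) unfolding H_def short_points_def by blast
      \<comment> \<open>The difference \<open>k - h r\<close> of natural numbers is then not
        truncated. For smaller \<open>k\<close> the bound on \<open>card (H r k)\<close> is below
        1.\<close>
      have "h r \<le> k"
      proof (rule ccontr)
        assume "\<not> h r \<le> k"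
        have "real (card (H r k)) \<le> 2 * 2 powr (real k - \<epsilon> * real r)" using cardH elim(6) k by blast
        also have "\<dots> = 2 powr (1 + real k - \<epsilon> * real r)" by (simp add: powr_add powr_diff)
        also have "\<dots> < 2 powr 0"
        proof (rule powr_less_mono)
          have "2 < \<epsilon> * real r" using elim(4) pos(1) by (simp add: field_simps)
          then show "1 + real k - \<epsilon> * real r < 0" using h(1)[of r] \<open>\<not> h r \<le> k\<close> by linarith
        qed simp
        finally have "H r k = {}" using finH by simp
        then show False using pH by simp
      qed
      then have "p \<in> S r (k - h r)" using pH elim(6) k by (simp add: S_def S3_def)
      from code[OF this p(2), of A] have "?KB r \<le> (1 + \<epsilon> / 100) * real (k - h r) + c" .
      also have "(1 + \<epsilon> / 100) * real (k - h r) = real k - real (h r) + \<epsilon> / 100 * real (k - h r)"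
        using \<open>h r \<le> k\<close> by (simp add: algebra_simps of_nat_diff)
      also have "\<epsilon> / 100 * real (k - h r) \<le> \<epsilon> / 100 * (7 * real r)"
        using k pos(1) by (intro mult_left_mono) auto
      finally have "?KB r \<le> real k - real (h r) + \<epsilon> / 100 * (7 * real r) + c" by simp
      \<comment> \<open>The saving of about \<open>\<epsilon> / 2 * r\<close> bits exceeds the
        tolerance \<open>\<epsilon> / 8 * r\<close> plus the coding overhead
        \<open>7 * \<epsilon> / 100 * r\<close>.\<close>
      then have "real k - \<epsilon> / 8 * real r \<le> real k - (\<epsilon> * real r / 2 - 1) + \<epsilon> / 100 * (7 * real r) + c"
        using elim(1) h(2)[of r] unfolding k_def by linarith
      moreover have "0 \<le> \<epsilon> * real r" using pos by simp
      ultimately show False using elim(5) by simp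
    qed
  qed
  then show False using T(3)[OF x(1)] by (simp add: frequently_def)
qed

theorem theorem1:
  fixes U :: otm and E :: "(real ^ 2) set" and s :: real
  assumes "universal_prefix_free_otm U"
    and "has_optimal_oracles U E"
    and "0 < s" and "ennreal s \<le> min (hausdorff_dim E) 1"
  shows "hausdorff_dim {e \<in> sphere (0 :: real ^ 2) 1. hausdorff_dim ((\<lambda>x. e \<bullet> x) ` E) < ennreal s}
           \<le> ennreal s"
proof -
  obtain A where A: "hausdorff_optimal U A E" using assms(2) unfolding has_optimal_oracles_def by blast
  have s: "s \<le> 1" "ennreal s \<le> hausdorff_dim E" using assms(4) by (simp_all add: ennreal_le_1)
  let ?D = "{e \<in> sphere (0 :: real ^ 2) 1. hausdorff_dim ((\<lambda>x. e \<bullet> x) ` E) < ennreal s}"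
  \<comment> \<open>The offset 2 keeps \<open>\<epsilon> n\<close> below \<open>s\<close>. As
    \<open>\<epsilon> n\<close> tends to 0, every direction in \<open>?D\<close> leaves a gap of
    more than \<open>5 * \<epsilon> n\<close> for some \<open>n\<close>.\<close>
  define \<epsilon> where "\<epsilon> = (\<lambda>n. s / real (n + 2))"
  have \<epsilon>: "0 < \<epsilon> n" "\<epsilon> n < s" for n
  proof -
    show "0 < \<epsilon> n" using assms(3) by (simp add: \<epsilon>_def)
    have "s * 1 < s * real (n + 2)" using assms(3) by (intro mult_strict_left_mono) auto
    then show "\<epsilon> n < s" by (simp add: \<epsilon>_def pos_divide_less_eq)
  qed
  have D: "?D \<subseteq> (\<Union>n. {e. \<exists>\<^sub>F r in sequentially. e \<in> exceptions U A s (\<epsilon> n) r})"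
  proof
    fix e assume e: "e \<in> ?D"
    then obtain d where d: "hausdorff_dim ((\<lambda>x. e \<bullet> x) ` E) = ennreal d" "0 \<le> d" "d < s"
      by (cases "hausdorff_dim ((\<lambda>x. e \<bullet> x) ` E)") (auto simp: ennreal_less_iff)
    have "\<forall>\<^sub>F n in sequentially. 5 * \<epsilon> n < s - d" unfolding \<epsilon>_def using d(3) by real_asymp
    then obtain n where n: "5 * \<epsilon> n < s - d" by (meson eventually_happens trivial_limit_sequentially)
    have "\<exists>\<^sub>F r in sequentially. e \<in> exceptions U A s (\<epsilon> n) r"
    proof (rule frequently_exceptions[OF assms(1) A s \<epsilon>])
      show "hausdorff_dim ((\<lambda>x. e \<bullet> x) ` E) < ennreal (s - 5 * \<epsilon> n)"
        using d n by (simp add: ennreal_less_iff)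
    qed (use e in simp)
    then show "e \<in> (\<Union>n. {e. \<exists>\<^sub>F r in sequentially. e \<in> exceptions U A s (\<epsilon> n) r})" by blast
  qed
  have "covered s ?D (ennreal \<gamma>)" if \<gamma>: "0 < \<gamma>" for \<gamma>
  proof -
    have "covered s (\<Union>n. {e. \<exists>\<^sub>F r in sequentially. e \<in> exceptions U A s (\<epsilon> n) r})
        (\<Sum>n. ennreal (\<gamma> * (1 / 2) ^ Suc n))"
      using \<gamma> by (intro covered_UN covered_limsup_exceptions assms(1) \<epsilon>) simp
    moreover have "(\<Sum>n. ennreal (\<gamma> * (1 / 2) ^ Suc n)) = ennreal \<gamma>"
      using sums_mult[OF power_half_series, of \<gamma>] \<gamma> by (intro sums_unique[symmetric] sums_ennreal[THEN iffD2]) auto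
    ultimately show ?thesis using covered_mono[OF _ D order_refl] by simp
  qed
  then show ?thesis using assms(3) by (intro hausdorff_dim_le hausdorff_measure_0)
qed

end
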